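(* Let $\Bbbk$ be a field, $R=\Bbbk[x_1,\ldots,x_n]$, $\omega\in(\mathbb{Z}^+)^n$ a weight vector, $I\subset R$ an $\omega$-homogeneous ideal, $d=\dim(R/I)$, and assume that $A=\Bbbk[x_{n-d+1},\ldots,x_n]$ is a Noether normalization of $R/I$. With $\mathcal{B}_0$, $\mathcal{B}_1'$, $\psi_0$ and $\mathbf{h}_\alpha$ as defined in the context, the kernel of the $A$-module homomorphism $\psi_0:\bigoplus_{v\in\mathcal{B}_0}A(-\deg_\omega(v))\to R/I$ is $$\ker(\psi_0)=\langle \mathbf{h}_\alpha \mid \mathbf{x}^\alpha\in\mathcal{B}_1'\rangle ,$$ the $A$-submodule generated by the elements $\mathbf{h}_\alpha$.
   Context: $\Bbbk$ is an arbitrary field and $R=\Bbbk[x_1,\ldots,x_n]$ is graded by $\deg_\omega(x_i)=\omega_i$, where $\omega=(\omega_1,\ldots,\omega_n)\in(\mathbb{Z}^+)^n$; $I\subset R$ is homogeneous for this grading and $d=\dim(R/I)$ is the Krull dimension. "$A=\Bbbk[x_{n-d+1},\ldots,x_n]$ is a Noether normalization of $R/I$" means that the natural map $A\to R/I$ is injective and integral. Monomial order: $>_\omega$ is the $\omega$-graded reverse lexicographic order on $R$: $\mathbf{x}^\alpha>_\omega\mathbf{x}^\beta$ iff $\deg_\omega(\mathbf{x}^\alpha)>\deg_\omega(\mathbf{x}^\beta)$, or these degrees are equal and the last nonzero entry of $\alpha-\beta$ is negative. $\mathrm{in}(f)$ and $\mathrm{in}(I)$ denote the initial term and initial ideal for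 $>_\omega$, and $\mathcal{G}$ is the reduced Gröbner basis of $I$ for $>_\omega$. $\mathcal{B}_0$ is the (finite) set of monomials of $R$ not belonging to $\mathrm{in}(I)+\langle x_{n-d+1},\ldots,x_n\rangle$. Let $\{\boldsymbol\epsilon_v\mid v\in\mathcal{B}_0\}$ be the canonical basis of $\bigoplus_{v\in\mathcal{B}_0}A(-\deg_\omega(v))$; $\psi_0:\bigoplus_{v\in\mathcal{B}_0}A(-\deg_\omega(v))\to R/I$ is the graded $A$-module homomorphism with $\psi_0(\boldsymbol\epsilon_v)=v+I$. Let $\chi:R\to R$ be the $\Bbbk$-algebra morphism with $\chi(x_i)=x_i$ for $1\le i\le n-d$ and $\chi(x_j)=1$ for $n-d+1\le j\le n$, and let $J=\chi(\mathrm{in}(I))\cdot R$ be the ideal generated by $\chi(\mathrm{in}(I))$. For each $u\in\mathcal{B}_0\cap J$, let $I_u=(\mathrm{in}(I):u)\cap A$, a monomial ideal of $A$, and let $G(I_u)$ be its minimal monomial generating set. Set $$\mathcal{B}_1'=\{u\cdot M\mid u\in\mathcal{B}_0\cap J,\ M\in G(I_u)\}.$$ Each $\mathbf{x}^\alpha\in\mathcal{B}_1'$ is written uniquely as $\mathbf{x}^\alpha=u\cdot M_\alpha$ with $u=\chi(\mathbf{x}^\alpha)\in\mathcal{B}_0\cap J$ and $M_\alpha\in G(I_u)$. Let $r_\alpha$ be the remainder of the division of $\mathbf{x}^\alpha$ by $\mathcal{G}$; it can be written uniquely as $r_\alpha=\sum_{v\in\mathcal{B}_0}f_{\alpha,v}v$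 with $f_{\alpha,v}\in A$. Define $$\mathbf{h}_\alpha=M_\alpha\boldsymbol\epsilon_u-\sum_{v\in\mathcal{B}_0}f_{\alpha,v}\boldsymbol\epsilon_v\in\bigoplus_{v\in\mathcal{B}_0}A(-\deg_\omega(v)).$$ *)

theory Defs
  imports
    "HOL-Library.Poly_Mapping"
    "HOL-Library.Extended_Real"
    "HOL-Algebra.QuotRing"
    "HOL-Algebra.Module"
begin

section \<open>Polynomial rings\<close>

text \<open>
  Variables are indexed by natural numbers: an exponent vector is an element of
  \<^typ>\<open>nat \<Rightarrow>\<^sub>0 nat\<close>, and a polynomial maps exponent vectors to coefficients.  The ring
  \<open>k[x_i | i \<in> V]\<close> is the subring of polynomials involving only variables with index in \<open>V\<close>, so
  \<open>R = mpoly_ring {1..n}\<close> and \<open>A = mpoly_ring {n - d + 1..n}\<close>.  The truncated subtraction is harmless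
  because \<open>d = dim (R/I) \<le> n\<close>.  Monomials are represented by their exponent vectors.
\<close>

type_synonym mon = "nat \<Rightarrow>\<^sub>0 nat"
type_synonym 'k mpoly = "mon \<Rightarrow>\<^sub>0 'k"

definition mpoly_ring :: "nat set \<Rightarrow> 'k::comm_ring_1 mpoly ring" where
  "mpoly_ring V =
     \<lparr>carrier = {p. \<forall>\<mu>\<in>Poly_Mapping.keys p. Poly_Mapping.keys \<mu> \<subseteq> V},
      monoid.mult = (*), one = 1, zero = 0, add = (+)\<rparr>"

definition xpow :: "mon \<Rightarrow> 'k::comm_ring_1 mpoly" where
  "xpow \<alpha> = Poly_Mapping.single \<alpha> 1"

definition Var :: "nat \<Rightarrow> 'k::comm_ring_1 mpoly" where
  "Var i = xpow (Poly_Mapping.single i 1)"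

definition subst_poly :: "(nat \<Rightarrow> 'k mpoly) \<Rightarrow> 'k mpoly \<Rightarrow> 'k::comm_ring_1 mpoly" where
  "subst_poly \<sigma> p =
     (\<Sum>\<mu>\<in>Poly_Mapping.keys p. Poly_Mapping.single 0 (Poly_Mapping.lookup p \<mu>) *
        (\<Prod>i\<in>Poly_Mapping.keys \<mu>. \<sigma> i ^ Poly_Mapping.lookup \<mu> i))"


section \<open>Weighted grading, monomial order, initial ideals\<close>

definition wdeg :: "(nat \<Rightarrow> nat) \<Rightarrow> mon \<Rightarrow> nat" where
  "wdeg \<omega> \<mu> = (\<Sum>i\<in>Poly_Mapping.keys \<mu>. \<omega> i * Poly_Mapping.lookup \<mu> i)"

definition hom_component :: "(nat \<Rightarrow> nat) \<Rightarrow> nat \<Rightarrow> 'k mpoly \<Rightarrow> 'k::comm_ring_1 mpoly" where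
  "hom_component \<omega> k p =
     (\<Sum>\<mu> | \<mu> \<in> Poly_Mapping.keys p \<and> wdeg \<omega> \<mu> = k.
        Poly_Mapping.single \<mu> (Poly_Mapping.lookup p \<mu>))"

definition homogeneous_ideal ::
    "nat set \<Rightarrow> (nat \<Rightarrow> nat) \<Rightarrow> 'k::comm_ring_1 mpoly set \<Rightarrow> bool" where
  "homogeneous_ideal V \<omega> I \<longleftrightarrow>
     ideal I (mpoly_ring V) \<and> (\<forall>p\<in>I. \<forall>k. hom_component \<omega> k p \<in> I)"

definition wrevlex_greater :: "(nat \<Rightarrow> nat) \<Rightarrow> mon \<Rightarrow> mon \<Rightarrow> bool" where
  "wrevlex_greater \<omega> \<alpha> \<beta> \<longleftrightarrow>
     wdeg \<omega> \<alpha> > wdeg \<omega> \<beta> \<or>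
     (wdeg \<omega> \<alpha> = wdeg \<omega> \<beta> \<and>
      (\<exists>i. Poly_Mapping.lookup \<alpha> i < Poly_Mapping.lookup \<beta> i \<and>
           (\<forall>j>i. Poly_Mapping.lookup \<alpha> j = Poly_Mapping.lookup \<beta> j)))"

text \<open>Meaningful only for nonzero polynomials.\<close>

definition lead_mon :: "(nat \<Rightarrow> nat) \<Rightarrow> 'k::comm_ring_1 mpoly \<Rightarrow> mon" where
  "lead_mon \<omega> p =
     (THE \<mu>. \<mu> \<in> Poly_Mapping.keys p \<and>
        (\<forall>\<nu>\<in>Poly_Mapping.keys p. \<nu> = \<mu> \<or> wrevlex_greater \<omega> \<mu> \<nu>))"

definition init_term :: "(nat \<Rightarrow> nat) \<Rightarrow> 'k mpoly \<Rightarrow> 'k::comm_ring_1 mpoly" where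
  "init_term \<omega> p = Poly_Mapping.single (lead_mon \<omega> p) (Poly_Mapping.lookup p (lead_mon \<omega> p))"

definition init_ideal ::
    "nat \<Rightarrow> (nat \<Rightarrow> nat) \<Rightarrow> 'k mpoly set \<Rightarrow> 'k::comm_ring_1 mpoly set" where
  "init_ideal n \<omega> I = genideal (mpoly_ring {1..n}) {init_term \<omega> p |p. p \<in> I \<and> p \<noteq> 0}"


section \<open>Reduced Groebner basis and remainders\<close>

definition is_reduced_gb ::
    "nat \<Rightarrow> (nat \<Rightarrow> nat) \<Rightarrow> 'k::comm_ring_1 mpoly set \<Rightarrow> 'k mpoly set \<Rightarrow> bool" where
  "is_reduced_gb n \<omega> I G \<longleftrightarrow>
     finite G \<and> G \<subseteq> I \<and> 0 \<notin> G \<and>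
     genideal (mpoly_ring {1..n}) (init_term \<omega> ` G) = init_ideal n \<omega> I \<and>
     (\<forall>g\<in>G. Poly_Mapping.lookup g (lead_mon \<omega> g) = 1) \<and>
     (\<forall>g\<in>G. \<forall>\<mu>\<in>Poly_Mapping.keys g.
        xpow \<mu> \<notin> genideal (mpoly_ring {1..n}) (init_term \<omega> ` (G - {g})))"

definition reduced_gb ::
    "nat \<Rightarrow> (nat \<Rightarrow> nat) \<Rightarrow> 'k mpoly set \<Rightarrow> 'k::comm_ring_1 mpoly set" where
  "reduced_gb n \<omega> I = (THE G. is_reduced_gb n \<omega> I G)"

text \<open>
  \<open>r\<close> is a remainder of \<open>f\<close> on division by \<open>G\<close>: there is a standard representation
  \<open>f = (\<Sum>g\<in>G. q g * g) + r\<close>, and no monomial of \<open>r\<close> is divisible by an initial monomial of \<open>G\<close>.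
  It is unique when \<open>G\<close> is a Groebner basis.
\<close>

definition is_remainder ::
    "nat \<Rightarrow> (nat \<Rightarrow> nat) \<Rightarrow> 'k::comm_ring_1 mpoly set \<Rightarrow> 'k mpoly \<Rightarrow> 'k mpoly \<Rightarrow> bool" where
  "is_remainder n \<omega> G f r \<longleftrightarrow>
     r \<in> carrier (mpoly_ring {1..n}) \<and>
     (\<forall>\<mu>\<in>Poly_Mapping.keys r. \<forall>g\<in>G. \<nexists>\<nu>. \<mu> = lead_mon \<omega> g + \<nu>) \<and>
     (\<exists>q. (\<forall>g\<in>G. q g \<in> carrier (mpoly_ring {1..n}) \<and>
             (q g * g \<noteq> 0 \<longrightarrow>
                f \<noteq> 0 \<and> \<not> wrevlex_greater \<omega> (lead_mon \<omega> (q g * g)) (lead_mon \<omega> f))) \<and>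
          f = (\<Sum>g\<in>G. q g * g) + r)"

definition remainder ::
    "nat \<Rightarrow> (nat \<Rightarrow> nat) \<Rightarrow> 'k mpoly set \<Rightarrow> 'k mpoly \<Rightarrow> 'k::comm_ring_1 mpoly" where
  "remainder n \<omega> G f = (THE r. is_remainder n \<omega> G f r)"


section \<open>Krull dimension and Noether normalizations\<close>

text \<open>The zero ring has dimension \<open>-\<infinity>\<close>.\<close>

definition krull_dim :: "('a, 'b) ring_scheme \<Rightarrow> ereal" where
  "krull_dim S =
     Sup {ereal (real k) |k. \<exists>P. (\<forall>i\<le>k. primeideal (P i) S) \<and> (\<forall>i<k. P i \<subset> P (Suc i))}"

text \<open>Every element of \<open>S\<close> is a root of a monic polynomial of degree \<open>m\<close> with coefficients in the
  image of \<open>A\<close>.\<close>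

definition integral_map ::
    "('a, 'c) ring_scheme \<Rightarrow> ('b, 'd) ring_scheme \<Rightarrow> ('a \<Rightarrow> 'b) \<Rightarrow> bool" where
  "integral_map A S \<phi> \<longleftrightarrow>
     (\<forall>y\<in>carrier S. \<exists>m::nat. \<exists>c. (\<forall>i<m. c i \<in> carrier A) \<and>
        y [^]\<^bsub>S\<^esub> m \<oplus>\<^bsub>S\<^esub> (\<Oplus>\<^bsub>S\<^esub>i\<in>{..<m}. \<phi> (c i) \<otimes>\<^bsub>S\<^esub> y [^]\<^bsub>S\<^esub> i) = \<zero>\<^bsub>S\<^esub>)"

definition noether_normalization ::
    "nat \<Rightarrow> nat \<Rightarrow> 'k::comm_ring_1 mpoly set \<Rightarrow> bool" where
  "noether_normalization n d I \<longleftrightarrow>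
     (let R = mpoly_ring {1..n}; A = mpoly_ring {n - d + 1..n}; \<phi> = (\<lambda>a. I +>\<^bsub>R\<^esub> a)
      in inj_on \<phi> (carrier A) \<and> integral_map A (R Quot I) \<phi>)"


section \<open>The first step of the resolution\<close>

definition B0 :: "nat \<Rightarrow> nat \<Rightarrow> (nat \<Rightarrow> nat) \<Rightarrow> 'k::comm_ring_1 mpoly set \<Rightarrow> mon set" where
  "B0 n d \<omega> I =
     {v. Poly_Mapping.keys v \<subseteq> {1..n} \<and>
         (xpow v :: 'k mpoly) \<notin> init_ideal n \<omega> I <+>\<^bsub>mpoly_ring {1..n}\<^esub>
           genideal (mpoly_ring {1..n}) (Var ` {n - d + 1..n})}"

text \<open>
  The direct sum of copies of \<open>k[x_i | i \<in> V]\<close> indexed by \<open>B\<close>; the basis element with index \<open>v\<close> is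
  \<open>Poly_Mapping.single v 1\<close>.  Degree shifts do not change the underlying module and are not
  recorded.  The fields \<^const>\<open>monoid.mult\<close> and \<^const>\<open>one\<close> are present only because module
  records extend ring records.
\<close>

definition free_module ::
    "nat set \<Rightarrow> mon set \<Rightarrow> ('k::comm_ring_1 mpoly, mon \<Rightarrow>\<^sub>0 'k mpoly) module" where
  "free_module V B =
     \<lparr>carrier = {F. Poly_Mapping.keys F \<subseteq> B \<and>
        (\<forall>v. Poly_Mapping.lookup F v \<in> carrier (mpoly_ring V))},
      monoid.mult = undefined, one = undefined, zero = 0, add = (+),
      smult = (\<lambda>a. Poly_Mapping.map ((*) a))\<rparr>"

definition submodule_generated ::
    "('a, 'c) ring_scheme \<Rightarrow> ('a, 'b, 'd) module_scheme \<Rightarrow> 'b set \<Rightarrow> 'b set" where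
  "submodule_generated A M S = \<Inter>{N. submodule N A M \<and> S \<subseteq> N}"

definition F0 ::
    "nat \<Rightarrow> nat \<Rightarrow> (nat \<Rightarrow> nat) \<Rightarrow> 'k::comm_ring_1 mpoly set \<Rightarrow>
     ('k mpoly, mon \<Rightarrow>\<^sub>0 'k mpoly) module" where
  "F0 n d \<omega> I = free_module {n - d + 1..n} (B0 n d \<omega> I)"

definition combine :: "(mon \<Rightarrow>\<^sub>0 'k mpoly) \<Rightarrow> 'k::comm_ring_1 mpoly" where
  "combine F = (\<Sum>v\<in>Poly_Mapping.keys F. Poly_Mapping.lookup F v * xpow v)"

definition \<psi>0 ::
    "nat \<Rightarrow> 'k mpoly set \<Rightarrow> (mon \<Rightarrow>\<^sub>0 'k mpoly) \<Rightarrow> 'k::comm_ring_1 mpoly set" where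
  "\<psi>0 n I F = I +>\<^bsub>mpoly_ring {1..n}\<^esub> combine F"

definition \<chi> :: "nat \<Rightarrow> nat \<Rightarrow> 'k mpoly \<Rightarrow> 'k::comm_ring_1 mpoly" where
  "\<chi> n d = subst_poly (\<lambda>i. if i \<in> {n - d + 1..n} then 1 else Var i)"

definition J_ideal ::
    "nat \<Rightarrow> nat \<Rightarrow> (nat \<Rightarrow> nat) \<Rightarrow> 'k mpoly set \<Rightarrow> 'k::comm_ring_1 mpoly set" where
  "J_ideal n d \<omega> I = genideal (mpoly_ring {1..n}) (\<chi> n d ` init_ideal n \<omega> I)"

definition I_colon ::
    "nat \<Rightarrow> nat \<Rightarrow> (nat \<Rightarrow> nat) \<Rightarrow> 'k mpoly set \<Rightarrow> mon \<Rightarrow> 'k::comm_ring_1 mpoly set" where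
  "I_colon n d \<omega> I u =
     {p \<in> carrier (mpoly_ring {1..n}). p * xpow u \<in> init_ideal n \<omega> I} \<inter>
     carrier (mpoly_ring {n - d + 1..n})"

definition is_min_mon_gens ::
    "nat set \<Rightarrow> 'k::comm_ring_1 mpoly set \<Rightarrow> mon set \<Rightarrow> bool" where
  "is_min_mon_gens V K S \<longleftrightarrow>
     (\<forall>\<mu>\<in>S. Poly_Mapping.keys \<mu> \<subseteq> V) \<and>
     genideal (mpoly_ring V) (xpow ` S) = K \<and>
     (\<forall>T\<subset>S. genideal (mpoly_ring V) (xpow ` T) \<noteq> K)"

definition min_mon_gens :: "nat set \<Rightarrow> 'k::comm_ring_1 mpoly set \<Rightarrow> mon set" where
  "min_mon_gens V K = (THE S. is_min_mon_gens V K S)"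

definition B1' :: "nat \<Rightarrow> nat \<Rightarrow> (nat \<Rightarrow> nat) \<Rightarrow> 'k::comm_ring_1 mpoly set \<Rightarrow> mon set" where
  "B1' n d \<omega> I =
     {u + M |u M. u \<in> B0 n d \<omega> I \<and> xpow u \<in> J_ideal n d \<omega> I \<and>
        M \<in> min_mon_gens {n - d + 1..n} (I_colon n d \<omega> I u)}"

text \<open>The element \<open>\<Sum>v. f_{\<alpha>,v} \<epsilon>_v\<close> whose coefficients express \<open>r_\<alpha>\<close> in terms of \<open>B0\<close>.\<close>

definition f_coeffs ::
    "nat \<Rightarrow> nat \<Rightarrow> (nat \<Rightarrow> nat) \<Rightarrow> 'k::comm_ring_1 mpoly set \<Rightarrow> mon \<Rightarrow> (mon \<Rightarrow>\<^sub>0 'k mpoly)" where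
  "f_coeffs n d \<omega> I \<alpha> =
     (THE F. F \<in> carrier (F0 n d \<omega> I) \<and>
        combine F = remainder n \<omega> (reduced_gb n \<omega> I) (xpow \<alpha>))"

definition h_elem ::
    "nat \<Rightarrow> nat \<Rightarrow> (nat \<Rightarrow> nat) \<Rightarrow> 'k::comm_ring_1 mpoly set \<Rightarrow> mon \<Rightarrow> (mon \<Rightarrow>\<^sub>0 'k mpoly)" where
  "h_elem n d \<omega> I \<alpha> =
     (let u = (THE u. (xpow u :: 'k mpoly) = \<chi> n d (xpow \<alpha>)); M = (THE M. \<alpha> = u + M)
      in Poly_Mapping.single u (xpow M) - f_coeffs n d \<omega> I \<alpha>)"

end

theory Submission
  imports Defs
begin

text \<open>
  Fix a nonzero \<open>F\<close> in the kernel.  The initial monomial of its image in \<open>I\<close> is \<open>u M\<close> with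
  \<open>u \<in> B0\<close> and \<open>M \<in> I_u\<close>, so \<open>M\<close> is a multiple of some \<open>M' \<in> G(I_u)\<close>.  Since the remainder
  \<open>r_\<alpha>\<close> of \<open>x^\<alpha> = u M'\<close> only involves monomials smaller than \<open>x^\<alpha>\<close>, subtracting a suitable
  term times \<open>h_\<alpha>\<close> from \<open>F\<close> lowers this initial monomial.  The order is a well-order on the monomials of
  \<open>R\<close>, so the process ends at an element mapping to \<open>0\<close> in \<open>R\<close>, which is \<open>0\<close> because distinct
  products \<open>v M\<close> with \<open>v \<in> B0\<close> and \<open>M \<in> A\<close> are distinct monomials.
\<close>

text \<open>The reduced basis, the remainders, the sets G(I_u) and the coefficients f_{\<alpha>,v}
  are all introduced by definite descriptions, so nothing can be said about h_\<alpha> before each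
  has been shown to exist and to be unique. Existence of the basis rests on Dickson's lemma.
  Uniqueness of the basis and of the remainders has a single source: an element of I none of whose
  monomials lies in in(I) is zero. Throughout, a monomial ideal (in(I), its sum with the ideal of
  the variables of A, I_u) is replaced by the set of monomials it contains, and membership of a
  polynomial is tested on its monomials. The kernel itself is rewritten as the set of
  \<open>F\<close> whose polynomial \<open>combine F\<close> lies in I, so that the descent takes
  place in R and not in the quotient.\<close>

abbreviation keys :: "('a \<Rightarrow>\<^sub>0 'b::zero) \<Rightarrow> 'a set" where "keys \<equiv> Poly_Mapping.keys"
abbreviation lookup :: "('a \<Rightarrow>\<^sub>0 'b::zero) \<Rightarrow> 'a \<Rightarrow> 'b" where "lookup \<equiv> Poly_Mapping.lookup"
abbreviation single :: "'a \<Rightarrow> 'b \<Rightarrow> 'a \<Rightarrow>\<^sub>0 'b::zero" where "single \<equiv> Poly_Mapping.single"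

section \<open>Exponent vectors\<close>

lemma keys_add_nat: "keys (\<mu> + \<nu>) = keys \<mu> \<union> keys (\<nu> :: 'a \<Rightarrow>\<^sub>0 nat)"
  by (auto simp: in_keys_iff lookup_add)

text \<open>\<open>W\<close> will be the index set of the variables of A: \<open>u\<close> is what
  survives when these variables are set to 1, and \<open>M\<close> is the factor coming from
  A.\<close>

lemma mon_split:
  fixes \<kappa> :: "'a \<Rightarrow>\<^sub>0 nat"
  obtains u M where "\<kappa> = u + M" "keys u \<inter> W = {}" "keys M \<subseteq> W"
proof
  let ?u = "Poly_Mapping.mapp (\<lambda>i c. if i \<in> W then 0 else c) \<kappa>"
  let ?M = "Poly_Mapping.mapp (\<lambda>i c. if i \<in> W then c else 0) \<kappa>"
  show "\<kappa> = ?u + ?M"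
    by (intro poly_mapping_eqI) (auto simp: lookup_add lookup_mapp when_def in_keys_iff)
  show "keys ?u \<inter> W = {}" "keys ?M \<subseteq> W"
    by (auto simp: in_keys_iff lookup_mapp when_def split: if_splits)
qed

text \<open>Compare exponents: \<open>u\<close> and \<open>v\<close> vanish on \<open>W\<close>,
  \<open>M\<close> and \<open>N\<close> vanish off \<open>W\<close>. This later makes the free
  module embed into R.\<close>

lemma mon_split_unique:
  fixes u v M N :: "'a \<Rightarrow>\<^sub>0 nat"
  assumes eq: "u + M = v + N"
    and "keys u \<inter> W = {}" "keys v \<inter> W = {}" "keys M \<subseteq> W" "keys N \<subseteq> W"
  shows "u = v \<and> M = N"
proof -
  have "u = v"
  proof (rule poly_mapping_eqI)
    fix i
    have "lookup u i + lookup M i = lookup v i + lookup N i"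
      using eq by (metis lookup_add)
    moreover have "i \<in> W \<Longrightarrow> lookup u i = 0 \<and> lookup v i = 0"
      and "i \<notin> W \<Longrightarrow> lookup M i = 0 \<and> lookup N i = 0"
      using assms(2-5) by (auto simp: in_keys_iff)
    ultimately show "lookup u i = lookup v i"
      by (cases "i \<in> W") auto
  qed
  with eq show ?thesis by simp
qed

lemma mon_dvd_iff: "(\<exists>\<nu>. \<beta> = \<alpha> + \<nu>) \<longleftrightarrow> (\<forall>i. lookup \<alpha> i \<le> lookup \<beta> i)"
  for \<alpha> \<beta> :: "'a \<Rightarrow>\<^sub>0 nat"
proof
  assume le: "\<forall>i. lookup \<alpha> i \<le> lookup \<beta> i"
  have "\<beta> = \<alpha> + (\<beta> - \<alpha>)"
    using le by (intro poly_mapping_eqI) (simp add: lookup_add lookup_minus)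
  then show "\<exists>\<nu>. \<beta> = \<alpha> + \<nu>" ..
qed (auto simp: lookup_add)

section \<open>Dickson's lemma and minimal monomials\<close>

lemma monotone_subsequence:
  fixes f :: "nat \<Rightarrow> 'a \<Rightarrow>\<^sub>0 nat"
  assumes "finite V"
  shows "\<exists>r::nat \<Rightarrow> nat. strict_mono r \<and> (\<forall>i\<in>V. \<forall>k l. k \<le> l \<longrightarrow> lookup (f (r k)) i \<le> lookup (f (r l)) i)"
  using assms
proof (induction V)
  case empty
  then show ?case by (auto intro: strict_mono_id[unfolded id_def])
next
  \<comment> \<open>A further subsequence keeps the coordinates in \<open>V\<close> monotone, so
    only the one sequence of numbers given by the new coordinate remains to be treated.\<close>
  case (insert x V)
  then obtain r :: "nat \<Rightarrow> nat" where r: "strict_mono r"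
    "\<And>i k l. i \<in> V \<Longrightarrow> k \<le> l \<Longrightarrow> lookup (f (r k)) i \<le> lookup (f (r l)) i"
    by blast
  define h where "h k = lookup (f (r k)) x" for k
  have "\<exists>s::nat \<Rightarrow> nat. strict_mono s \<and> (\<forall>k l. k \<le> l \<longrightarrow> h (s k) \<le> h (s l))"
  proof -
    \<comment> \<open>Tail minima: \<open>m N\<close> is the least value of \<open>h\<close> from
      index \<open>N\<close> on, and \<open>pick N\<close> is an index attaining it. Picking each
      time beyond the previous index gives increasing indices, and each picked value bounds all
      later values from below.\<close>
    define m where "m N = (LEAST c. \<exists>k\<ge>N. h k = c)" for N
    have m_attained: "\<exists>k\<ge>N. h k = m N" for N
      unfolding m_def by (rule LeastI_ex) auto
    have m_le: "m N \<le> h k" if "N \<le> k" for N k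
      unfolding m_def using that by (intro Least_le) auto
    define pick where "pick N = (SOME k. k \<ge> N \<and> h k = m N)" for N
    have pick: "pick N \<ge> N" "h (pick N) = m N" for N
      using someI_ex[OF m_attained[of N, unfolded Bex_def]] unfolding pick_def by auto
    define s where "s = rec_nat (pick 0) (\<lambda>_ k. pick (Suc k))"
    have s_Suc: "s (Suc k) = pick (Suc (s k))" for k by (simp add: s_def)
    have s_pick: "\<exists>N. s k = pick N" for k by (cases k) (auto simp: s_def)
    have less: "s k < s (Suc k)" for k
      unfolding s_Suc using pick(1)[of "Suc (s k)"] by simp
    have "h (s k) \<le> h (s (Suc k))" for k
    proof -
      obtain N where N: "s k = pick N" using s_pick by blast
      then have "N \<le> s (Suc k)" using pick(1)[of N] less[of k] by simp
      then show ?thesis using m_le N pick(2) by simp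
    qed
    then have "h (s k) \<le> h (s l)" if "k \<le> l" for k l
      using lift_Suc_mono_le[of "\<lambda>k. h (s k)"] that by blast
    moreover have "strict_mono s" using less by (simp add: strict_mono_Suc_iff)
    ultimately show ?thesis by blast
  qed
  then obtain s :: "nat \<Rightarrow> nat" where s: "strict_mono s" "\<And>k l. k \<le> l \<Longrightarrow> h (s k) \<le> h (s l)"
    by blast
  have "strict_mono (r \<circ> s)" using r(1) s(1) by (rule strict_mono_o)
  moreover have "lookup (f ((r \<circ> s) k)) i \<le> lookup (f ((r \<circ> s) l)) i"
    if "i \<in> insert x V" "k \<le> l" for i k l
    using that r(2)[of i "s k" "s l"] s(2)[of k l] strict_mono_leD[OF s(1), of k l]
    by (auto simp: h_def)
  ultimately show ?case by blast
qed

text \<open>Minimality is for divisibility, written additively. For the set of monomials of a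
  monomial ideal this yields the minimal generators; both in(I) and I_u are treated this
  way.\<close>

definition minimal_mons :: "('a \<Rightarrow>\<^sub>0 nat) set \<Rightarrow> ('a \<Rightarrow>\<^sub>0 nat) set" where
  "minimal_mons D = {\<mu> \<in> D. \<forall>\<mu>'\<in>D. \<forall>\<nu>. \<mu> = \<mu>' + \<nu> \<longrightarrow> \<mu>' = \<mu>}"

text \<open>An infinite set of minimal monomials would contain an injective sequence. In a
  subsequence monotone in every coordinate the first member divides the second, so minimality makes
  them equal, against injectivity.\<close>

lemma Dickson:
  fixes D :: "('a \<Rightarrow>\<^sub>0 nat) set"
  assumes "finite V" "\<And>\<mu>. \<mu> \<in> D \<Longrightarrow> keys \<mu> \<subseteq> V"
  shows "finite (minimal_mons D)"
proof (rule ccontr)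
  assume "infinite (minimal_mons D)"
  then obtain f :: "nat \<Rightarrow> 'a \<Rightarrow>\<^sub>0 nat" where f: "inj f" "range f \<subseteq> minimal_mons D"
    using infinite_countable_subset by blast
  obtain r :: "nat \<Rightarrow> nat" where r: "strict_mono r"
    "\<And>i k l. i \<in> V \<Longrightarrow> k \<le> l \<Longrightarrow> lookup (f (r k)) i \<le> lookup (f (r l)) i"
    using monotone_subsequence[OF assms(1), of f] by blast
  have mem: "f k \<in> minimal_mons D" for k using f(2) by auto
  have "lookup (f (r 0)) i \<le> lookup (f (r 1)) i" for i
  proof (cases "i \<in> V")
    case False
    then have "i \<notin> keys (f (r 0))" using mem[of "r 0"] assms(2) by (auto simp: minimal_mons_def)
    then show ?thesis by (simp add: in_keys_iff)
  qed (simp add: r(2))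
  then have "f (r 0) = f (r 1)"
    using mem[of "r 0"] mem[of "r 1"] mon_dvd_iff[of "f (r 1)" "f (r 0)"]
    unfolding minimal_mons_def by blast
  moreover have "r 0 < r 1" using r(1) by (simp add: strict_mono_def)
  ultimately show False using f(1) by (metis injD less_irrefl)
qed

lemma minimal_mons_below:
  fixes D :: "('a \<Rightarrow>\<^sub>0 nat) set"
  assumes "\<mu> \<in> D"
  obtains \<mu>' \<nu> where "\<mu>' \<in> minimal_mons D" "\<mu> = \<mu>' + \<nu>"
proof -
  \<comment> \<open>The unweighted total degree is additive and vanishes only at the monomial 1, so
    it drops on passing to a proper divisor.\<close>
  define size where "size \<mu> = (\<Sum>i\<in>keys \<mu>. lookup \<mu> i)" for \<mu> :: "'a \<Rightarrow>\<^sub>0 nat"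
  have size_add: "size (\<alpha> + \<beta>) = size \<alpha> + size \<beta>" for \<alpha> \<beta>
  proof -
    have "size \<gamma> = (\<Sum>i\<in>keys (\<alpha> + \<beta>). lookup \<gamma> i)" if "keys \<gamma> \<subseteq> keys (\<alpha> + \<beta>)" for \<gamma>
      unfolding size_def using that by (intro sum.mono_neutral_left) (auto simp: in_keys_iff)
    then show ?thesis by (simp add: keys_add_nat lookup_add sum.distrib)
  qed
  have size_0: "\<beta> = 0" if "size \<beta> = 0" for \<beta>
    using that by (intro poly_mapping_eqI) (auto simp: size_def in_keys_iff)
  have "\<exists>\<mu>'\<in>minimal_mons D. \<exists>\<nu>. \<mu> = \<mu>' + \<nu>"
    using assms
  proof (induction "size \<mu>" arbitrary: \<mu> rule: less_induct)
    case less
    show ?case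
    proof (cases "\<mu> \<in> minimal_mons D")
      case True
      then show ?thesis by (intro bexI[of _ \<mu>] exI[of _ 0]) auto
    next
      case False
      then obtain \<mu>1 \<nu> where *: "\<mu>1 \<in> D" "\<mu> = \<mu>1 + \<nu>" "\<mu>1 \<noteq> \<mu>"
        using less.prems unfolding minimal_mons_def by blast
      then have "size \<mu>1 < size \<mu>" using size_0[of \<nu>] by (auto simp: size_add)
      then show ?thesis using less.hyps * by (metis add.assoc)
    qed
  qed
  then show ?thesis using that by blast
qed

section \<open>The weighted reverse lexicographic order\<close>

lemma wdeg_superset:
  assumes "finite A" "keys \<mu> \<subseteq> A"
  shows "wdeg \<omega> \<mu> = (\<Sum>i\<in>A. \<omega> i * lookup \<mu> i)"
  unfolding wdeg_def using assms by (intro sum.mono_neutral_left) (auto simp: in_keys_iff)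

lemma wdeg_add: "wdeg \<omega> (\<mu> + \<nu>) = wdeg \<omega> \<mu> + wdeg \<omega> \<nu>"
  using wdeg_superset[of "keys \<mu> \<union> keys \<nu>" _ \<omega>]
  by (simp add: keys_add_nat lookup_add sum.distrib distrib_left)

lemma wrevlex_irrefl: "\<not> wrevlex_greater \<omega> \<alpha> \<alpha>"
  by (simp add: wrevlex_greater_def)

lemma wrevlex_trans:
  assumes "wrevlex_greater \<omega> \<alpha> \<beta>" "wrevlex_greater \<omega> \<beta> \<gamma>"
  shows "wrevlex_greater \<omega> \<alpha> \<gamma>"
proof (cases "wdeg \<omega> \<alpha> = wdeg \<omega> \<beta> \<and> wdeg \<omega> \<beta> = wdeg \<omega> \<gamma>")
  case True
  then obtain i j where
    "lookup \<alpha> i < lookup \<beta> i" "\<forall>k>i. lookup \<alpha> k = lookup \<beta> k"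
    "lookup \<beta> j < lookup \<gamma> j" "\<forall>k>j. lookup \<beta> k = lookup \<gamma> k"
    using assms unfolding wrevlex_greater_def by auto
  \<comment> \<open>The larger of the two deciding positions decides between \<alpha> and \<gamma>,
    since beyond it all three vectors agree.\<close>
  then have "lookup \<alpha> (max i j) < lookup \<gamma> (max i j) \<and> (\<forall>k>max i j. lookup \<alpha> k = lookup \<gamma> k)"
    by (cases i j rule: linorder_cases) auto
  then have "\<exists>i. lookup \<alpha> i < lookup \<gamma> i \<and> (\<forall>k>i. lookup \<alpha> k = lookup \<gamma> k)" ..
  then show ?thesis using True by (simp add: wrevlex_greater_def)
next
  case False
  have "wdeg \<omega> \<alpha> \<ge> wdeg \<omega> \<beta>" "wdeg \<omega> \<beta> \<ge> wdeg \<omega> \<gamma>"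
    using assms by (auto simp only: wrevlex_greater_def)
  with False show ?thesis unfolding wrevlex_greater_def by linarith
qed

lemma wrevlex_asym: "wrevlex_greater \<omega> \<alpha> \<beta> \<Longrightarrow> \<not> wrevlex_greater \<omega> \<beta> \<alpha>"
  using wrevlex_irrefl[of \<omega> \<alpha>] wrevlex_trans[of \<omega> \<alpha> \<beta> \<alpha>] by blast

text \<open>Supports are finite, so the positions of disagreement have a maximum, the place of the
  last nonzero entry of \<alpha> - \<beta>, which settles a tie in degree.\<close>

lemma wrevlex_total:
  assumes "\<alpha> \<noteq> \<beta>"
  shows "wrevlex_greater \<omega> \<alpha> \<beta> \<or> wrevlex_greater \<omega> \<beta> \<alpha>"
proof -
  let ?N = "{i. lookup \<alpha> i \<noteq> lookup \<beta> i}"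
  have fin: "finite ?N"
    by (rule finite_subset[of _ "keys \<alpha> \<union> keys \<beta>"]) (auto simp: in_keys_iff)
  have "?N \<noteq> {}" using assms poly_mapping_eqI[of \<alpha> \<beta>] by blast
  then have "Max ?N \<in> ?N" using fin by (rule Max_in[rotated])
  moreover have "lookup \<alpha> j = lookup \<beta> j" if "j > Max ?N" for j
    using that Max_ge[OF fin, of j] by fastforce
  ultimately show ?thesis
    unfolding wrevlex_greater_def by (metis (mono_tags, lifting) linorder_neqE_nat mem_Collect_eq)
qed

lemma wrevlex_add_left:
  "wrevlex_greater \<omega> (\<gamma> + \<alpha>) (\<gamma> + \<beta>) \<longleftrightarrow> wrevlex_greater \<omega> \<alpha> \<beta>"
  by (simp add: wrevlex_greater_def wdeg_add lookup_add)

text \<open>By totality the negated relation is the reflexive order "at most"; upper bounds on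
  monomials are written in this negated form from here on.\<close>

lemma wrevlex_not_greater_trans:
  assumes "\<not> wrevlex_greater \<omega> \<alpha> \<beta>" "\<not> wrevlex_greater \<omega> \<beta> \<gamma>"
  shows "\<not> wrevlex_greater \<omega> \<alpha> \<gamma>"
  using assms wrevlex_total[of \<beta> \<gamma> \<omega>] wrevlex_trans[of \<omega> \<alpha> \<gamma> \<beta>] by blast

text \<open>Positive weights make a proper multiple larger already in weighted degree.\<close>

lemma wrevlex_add_right_pos:
  assumes "\<forall>i\<in>V. \<omega> i > 0" "keys \<nu> \<subseteq> V" "\<nu> \<noteq> 0"
  shows "wrevlex_greater \<omega> (\<mu> + \<nu>) \<mu>"
proof -
  obtain i where "i \<in> keys \<nu>" using assms(3) poly_mapping_eqI[of \<nu> 0] by (auto simp: in_keys_iff)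
  then have "i \<in> V" "lookup \<nu> i > 0" using assms(2) by (auto simp: in_keys_iff)
  then have "0 < \<omega> i * lookup \<nu> i" using assms(1) by simp
  also have "\<dots> \<le> wdeg \<omega> \<nu>"
    unfolding wdeg_def using \<open>i \<in> keys \<nu>\<close> by (intro member_le_sum) auto
  finally show ?thesis by (simp add: wrevlex_greater_def wdeg_add)
qed

text \<open>Each weight is at least 1, so every exponent is at most \<open>b\<close>, and only
  finitely many functions supported on \<open>V\<close> stay within that bound.\<close>

lemma finite_wdeg_le:
  assumes "finite V" "\<forall>i\<in>V. \<omega> i > 0"
  shows "finite {\<mu>. keys \<mu> \<subseteq> V \<and> wdeg \<omega> \<mu> \<le> b}"
proof (rule finite_imageD)
  have "lookup \<mu> i \<le> b" if "keys \<mu> \<subseteq> V" "wdeg \<omega> \<mu> \<le> b" for \<mu> i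
  proof (cases "i \<in> keys \<mu>")
    case True
    then have "lookup \<mu> i \<le> \<omega> i * lookup \<mu> i" using assms(2) that(1) by fastforce
    also have "\<dots> \<le> wdeg \<omega> \<mu>"
      unfolding wdeg_def using True by (intro member_le_sum) auto
    finally show ?thesis using that(2) by simp
  qed (simp add: in_keys_iff)
  then have "lookup ` {\<mu>. keys \<mu> \<subseteq> V \<and> wdeg \<omega> \<mu> \<le> b}
      \<subseteq> {f. \<forall>i. (i \<in> V \<longrightarrow> f i \<in> {..b}) \<and> (i \<notin> V \<longrightarrow> f i = 0)}"
    by (auto simp: in_keys_iff)
  then show "finite (lookup ` {\<mu>. keys \<mu> \<subseteq> V \<and> wdeg \<omega> \<mu> \<le> b})"
    by (rule finite_subset) (rule finite_set_of_finite_funs[OF assms(1) finite_atMost])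
  show "inj_on lookup {\<mu>. keys \<mu> \<subseteq> V \<and> wdeg \<omega> \<mu> \<le> b}"
    by (intro inj_onI poly_mapping_eqI) simp
qed

text \<open>A smaller monomial has no larger degree, so only finitely many lie below a given one.
  Their number is a measure; it drops strictly because \<beta> lies below \<alpha> but not below
  itself.\<close>

lemma wf_wrevlex:
  assumes "finite V" "\<forall>i\<in>V. \<omega> i > 0"
  shows "wf {(\<beta>, \<alpha>). keys \<beta> \<subseteq> V \<and> keys \<alpha> \<subseteq> V \<and> wrevlex_greater \<omega> \<alpha> \<beta>}"
proof (rule wf_subset[OF wf_measure])
  let ?below = "\<lambda>\<alpha>. {\<beta>. keys \<beta> \<subseteq> V \<and> wrevlex_greater \<omega> \<alpha> \<beta>}"
  have fin: "finite (?below \<alpha>)" for \<alpha>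
    by (rule finite_subset[OF _ finite_wdeg_le[OF assms, of "wdeg \<omega> \<alpha>"]])
      (auto simp: wrevlex_greater_def)
  have "?below \<beta> \<subset> ?below \<alpha>" if "keys \<beta> \<subseteq> V" "wrevlex_greater \<omega> \<alpha> \<beta>" for \<alpha> \<beta>
  proof
    show "?below \<beta> \<subseteq> ?below \<alpha>" using that wrevlex_trans[of \<omega> \<alpha> \<beta>] by auto
    show "?below \<beta> \<noteq> ?below \<alpha>" using that wrevlex_irrefl[of \<omega> \<beta>] by blast
  qed
  then have "card (?below \<beta>) < card (?below \<alpha>)"
    if "keys \<beta> \<subseteq> V" "wrevlex_greater \<omega> \<alpha> \<beta>" for \<alpha> \<beta>
    using that fin by (intro psubset_card_mono) blast+
  then show "{(\<beta>, \<alpha>). keys \<beta> \<subseteq> V \<and> keys \<alpha> \<subseteq> V \<and> wrevlex_greater \<omega> \<alpha> \<beta>}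
      \<subseteq> measure (\<lambda>\<alpha>. card (?below \<alpha>))"
    by (simp add: subset_iff)
qed

section \<open>Initial monomials\<close>

lemma lead_mon_unique:
  assumes "\<mu> \<in> keys p" "\<And>\<nu>. \<nu> \<in> keys p \<Longrightarrow> \<nu> = \<mu> \<or> wrevlex_greater \<omega> \<mu> \<nu>"
  shows "lead_mon \<omega> p = \<mu>"
  unfolding lead_mon_def
proof (rule the_equality)
  fix \<kappa> assume "\<kappa> \<in> keys p \<and> (\<forall>\<nu>\<in>keys p. \<nu> = \<kappa> \<or> wrevlex_greater \<omega> \<kappa> \<nu>)"
  then show "\<kappa> = \<mu>" using assms wrevlex_asym[of \<omega> \<mu> \<kappa>] by metis
qed (use assms in blast)

lemma lead_mon:
  assumes "p \<noteq> 0"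
  shows lead_mon_in_keys: "lead_mon \<omega> p \<in> keys p"
    and lead_mon_greatest: "\<nu> \<in> keys p \<Longrightarrow> \<nu> = lead_mon \<omega> p \<or> wrevlex_greater \<omega> (lead_mon \<omega> p) \<nu>"
proof -
  have "\<exists>\<mu>\<in>A. \<forall>\<nu>\<in>A. \<nu> = \<mu> \<or> wrevlex_greater \<omega> \<mu> \<nu>" if "finite A" "A \<noteq> {}" for A
    using that
  proof (induction rule: finite_ne_induct)
    case (insert x A)
    then obtain \<mu> where "\<mu> \<in> A" "\<forall>\<nu>\<in>A. \<nu> = \<mu> \<or> wrevlex_greater \<omega> \<mu> \<nu>" by blast
    then have "(x = \<mu> \<or> wrevlex_greater \<omega> \<mu> x) \<or>
        (\<forall>\<nu>\<in>A. wrevlex_greater \<omega> x \<nu>)"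
      using wrevlex_total[of x \<mu> \<omega>] wrevlex_trans[of \<omega> x \<mu>] by metis
    then show ?case
      using \<open>\<mu> \<in> A\<close> \<open>\<forall>\<nu>\<in>A. \<nu> = \<mu> \<or> wrevlex_greater \<omega> \<mu> \<nu>\<close> by (metis insert_iff)
  qed auto
  from this[of "keys p"] obtain \<mu>
    where "\<mu> \<in> keys p" "\<And>\<nu>. \<nu> \<in> keys p \<Longrightarrow> \<nu> = \<mu> \<or> wrevlex_greater \<omega> \<mu> \<nu>"
    using assms poly_mapping_eqI[of p 0] by (metis finite_keys keys_zero lookup_zero not_in_keys_iff_lookup_eq_zero equals0D)
  moreover from this have "lead_mon \<omega> p = \<mu>" by (rule lead_mon_unique)
  ultimately show "lead_mon \<omega> p \<in> keys p"
    and "\<nu> \<in> keys p \<Longrightarrow> \<nu> = lead_mon \<omega> p \<or> wrevlex_greater \<omega> (lead_mon \<omega> p) \<nu>"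
    by simp_all
qed

lemma lead_mon_not_less: "\<nu> \<in> keys p \<Longrightarrow> \<not> wrevlex_greater \<omega> \<nu> (lead_mon \<omega> p)"
  using lead_mon_greatest[of p \<nu> \<omega>] wrevlex_asym[of \<omega> "lead_mon \<omega> p" \<nu>] wrevlex_irrefl[of \<omega> \<nu>]
  by (cases "p = 0") auto

lemma lead_mon_single: "c \<noteq> 0 \<Longrightarrow> lead_mon \<omega> (single \<mu> c) = \<mu>"
  by (rule lead_mon_unique) auto

section \<open>Polynomial rings and their ideals\<close>

lemma mpoly_ring_simps [simp]:
  "monoid.mult (mpoly_ring V) = (*)" "one (mpoly_ring V) = 1"
  "zero (mpoly_ring V) = 0" "add (mpoly_ring V) = (+)"
  by (simp_all add: mpoly_ring_def)

lemma mem_mpoly_ring: "p \<in> carrier (mpoly_ring V) \<longleftrightarrow> (\<forall>\<mu>\<in>keys p. keys \<mu> \<subseteq> V)"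
  by (simp add: mpoly_ring_def)

lemma mpoly_ring_add: "p \<in> carrier (mpoly_ring V) \<Longrightarrow> q \<in> carrier (mpoly_ring V) \<Longrightarrow>
    p + q \<in> carrier (mpoly_ring V)"
  using keys_add[of p q] by (auto simp: mem_mpoly_ring)

lemma mpoly_ring_uminus: "p \<in> carrier (mpoly_ring V) \<Longrightarrow> - p \<in> carrier (mpoly_ring V)"
  by (simp add: mem_mpoly_ring in_keys_iff)

lemma mpoly_ring_diff: "p \<in> carrier (mpoly_ring V) \<Longrightarrow> q \<in> carrier (mpoly_ring V) \<Longrightarrow>
    p - q \<in> carrier (mpoly_ring V)"
  using mpoly_ring_add[of p V "- q"] mpoly_ring_uminus[of q V] by simp

lemma mpoly_ring_mult: "p \<in> carrier (mpoly_ring V) \<Longrightarrow> q \<in> carrier (mpoly_ring V) \<Longrightarrow>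
    p * q \<in> carrier (mpoly_ring V)"
  using keys_mult[of p q] by (fastforce simp: mem_mpoly_ring keys_add_nat)

lemma mpoly_ring_0: "0 \<in> carrier (mpoly_ring V)"
  by (simp add: mem_mpoly_ring)

lemma mpoly_ring_1: "1 \<in> carrier (mpoly_ring V)"
  by (simp add: mem_mpoly_ring)

lemma mpoly_ring_single: "keys \<mu> \<subseteq> V \<Longrightarrow> single \<mu> c \<in> carrier (mpoly_ring V)"
  by (simp add: mem_mpoly_ring)

lemma mpoly_ring_sum: "(\<And>i. i \<in> A \<Longrightarrow> f i \<in> carrier (mpoly_ring V)) \<Longrightarrow>
    sum f A \<in> carrier (mpoly_ring V)"
  by (induction A rule: infinite_finite_induct) (simp_all add: mpoly_ring_0 mpoly_ring_add)

lemma mpoly_ring_mono: "V \<subseteq> W \<Longrightarrow> p \<in> carrier (mpoly_ring V) \<Longrightarrow> p \<in> carrier (mpoly_ring W)"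
  by (auto simp: mem_mpoly_ring)

lemma cring_mpoly_ring: "cring (mpoly_ring V)"
proof (intro cringI abelian_groupI comm_monoidI)
  fix x assume "x \<in> carrier (mpoly_ring V)"
  then show "\<exists>y\<in>carrier (mpoly_ring V). y \<oplus>\<^bsub>mpoly_ring V\<^esub> x = \<zero>\<^bsub>mpoly_ring V\<^esub>"
    by (intro bexI[of _ "- x"]) (simp_all add: mpoly_ring_uminus)
qed (simp_all add: mpoly_ring_add mpoly_ring_mult mpoly_ring_0 mpoly_ring_1 algebra_simps)

lemma ring_mpoly_ring: "ring (mpoly_ring V)"
  using cring_mpoly_ring by (rule cring.axioms)

lemma ideal_mpoly_ringI:
  fixes I :: "'k::comm_ring_1 mpoly set"
  assumes sub: "I \<subseteq> carrier (mpoly_ring V)" and zero: "0 \<in> I"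
    and add: "\<And>p q. p \<in> I \<Longrightarrow> q \<in> I \<Longrightarrow> p + q \<in> I"
    and mult: "\<And>p q. p \<in> carrier (mpoly_ring V) \<Longrightarrow> q \<in> I \<Longrightarrow> p * q \<in> I"
  shows "ideal I (mpoly_ring V)"
proof (rule idealI[OF ring_mpoly_ring])
  interpret R: cring "mpoly_ring V :: 'k mpoly ring" by (rule cring_mpoly_ring)
  show "subgroup I (add_monoid (mpoly_ring V))"
  proof (rule R.add.subgroupI)
    fix a assume a: "a \<in> I"
    then have "\<ominus>\<^bsub>mpoly_ring V\<^esub> a = - a"
      using sub mpoly_ring_uminus[of a V] by (intro R.minus_equality) auto
    moreover have "(- 1) * a \<in> I"
      using a by (intro mult mpoly_ring_uminus mpoly_ring_1)
    ultimately show "\<ominus>\<^bsub>mpoly_ring V\<^esub> a \<in> I" by simp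
  qed (use sub zero add in auto)
  fix a x :: "'k mpoly" assume "a \<in> I" "x \<in> carrier (mpoly_ring V)"
  then show "x \<otimes>\<^bsub>mpoly_ring V\<^esub> a \<in> I" "a \<otimes>\<^bsub>mpoly_ring V\<^esub> x \<in> I"
    using mult[of x a] by (simp_all add: mult.commute)
qed

lemma
  assumes "ideal I (mpoly_ring V)"
  shows ideal_mpoly_subset: "I \<subseteq> carrier (mpoly_ring V)"
    and ideal_mpoly_0: "0 \<in> I"
    and ideal_mpoly_add: "p \<in> I \<Longrightarrow> q \<in> I \<Longrightarrow> p + q \<in> I"
    and ideal_mpoly_mult: "r \<in> carrier (mpoly_ring V) \<Longrightarrow> p \<in> I \<Longrightarrow> r * p \<in> I"
    and ideal_mpoly_diff: "p \<in> I \<Longrightarrow> q \<in> I \<Longrightarrow> p - q \<in> I"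
proof -
  interpret ideal I "mpoly_ring V" by fact
  show "I \<subseteq> carrier (mpoly_ring V)" using a_subset .
  show "0 \<in> I" using additive_subgroup.zero_closed[OF additive_subgroup_axioms] by simp
  show add: "p + q \<in> I" if "p \<in> I" "q \<in> I" for p q using additive_subgroup.a_closed[OF additive_subgroup_axioms that] by simp
  show mult: "r * p \<in> I" if "r \<in> carrier (mpoly_ring V)" "p \<in> I" for r p
    using I_l_closed[OF that(2,1)] by simp
  show "p - q \<in> I" if "p \<in> I" "q \<in> I"
    using add[OF that(1) mult[OF mpoly_ring_uminus[OF mpoly_ring_1] that(2)]] by simp
qed

lemma ideal_mpoly_sum:
  assumes "ideal I (mpoly_ring V)" "\<And>i. i \<in> A \<Longrightarrow> f i \<in> I"
  shows "sum f A \<in> I"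
  using assms(2)
  by (induction A rule: infinite_finite_induct)
    (simp_all add: ideal_mpoly_0[OF assms(1)] ideal_mpoly_add[OF assms(1)])

section \<open>Monomials and monomial ideals\<close>

lemma sum_monomials: "p = (\<Sum>\<mu>\<in>keys p. single \<mu> (lookup p \<mu>))"
  by (rule poly_mapping_eqI) (simp add: lookup_sum lookup_single when_def in_keys_iff)

lemma lookup_single_mult: "lookup (single \<nu> c * p) (\<nu> + \<mu>) = c * lookup p \<mu>"
  for \<nu> :: mon and p :: "'k::comm_ring_1 mpoly"
proof -
  have "single \<nu> c * p = (\<Sum>\<kappa>\<in>keys p. single (\<nu> + \<kappa>) (c * lookup p \<kappa>))"
    by (subst sum_monomials[of p]) (simp add: sum_distrib_left mult_single)
  then show ?thesis
    by (simp add: lookup_sum lookup_single when_def in_keys_iff)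
qed

lemma keys_single_mult: "keys (single \<nu> c * p) \<subseteq> (+) \<nu> ` keys p"
  for \<nu> :: mon and p :: "'k::comm_ring_1 mpoly"
  using keys_mult[of "single \<nu> c" p] by (auto split: if_splits)

lemma xpow_mult: "xpow \<mu> * xpow \<nu> = (xpow (\<mu> + \<nu>) :: 'k::comm_ring_1 mpoly)"
  by (simp add: xpow_def mult_single)

lemma keys_xpow: "keys (xpow \<mu> :: 'k::comm_ring_1 mpoly) = {\<mu>}"
  by (simp add: xpow_def)

lemma inj_xpow: "xpow \<mu> = (xpow \<nu> :: 'k::comm_ring_1 mpoly) \<Longrightarrow> \<mu> = \<nu>"
  using keys_xpow[of \<mu>, where 'k='k] keys_xpow[of \<nu>, where 'k='k] by (metis singleton_inject)

lemma xpow_in_mpoly_ring: "(xpow \<mu> :: 'k::comm_ring_1 mpoly) \<in> carrier (mpoly_ring V) \<longleftrightarrow> keys \<mu> \<subseteq> V"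
  by (simp add: mem_mpoly_ring keys_xpow)

text \<open>The right-hand side is an ideal containing \<open>T\<close>, since divisibility survives
  sums and multiples. Conversely each term of such a polynomial is a multiple of an element of
  \<open>T\<close>; matching the coefficient divides by \<open>c\<close>, and this is where the
  field enters. Membership thus becomes a condition on monomials alone.\<close>

lemma genideal_terms:
  fixes T :: "'k::field mpoly set"
  assumes T: "\<And>t. t \<in> T \<Longrightarrow> \<exists>\<mu> c. t = single \<mu> c \<and> c \<noteq> 0 \<and> keys \<mu> \<subseteq> V"
  shows "genideal (mpoly_ring V) T =
    {p \<in> carrier (mpoly_ring V). \<forall>\<kappa>\<in>keys p. \<exists>t\<in>T. \<exists>\<mu>\<in>keys t. \<exists>\<nu>. \<kappa> = \<mu> + \<nu>}" (is "_ = ?K")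
proof
  interpret R: cring "mpoly_ring V :: 'k mpoly ring" by (rule cring_mpoly_ring)
  have TV: "T \<subseteq> carrier (mpoly_ring V)" using T mpoly_ring_single by blast
  have gen: "ideal (genideal (mpoly_ring V) T) (mpoly_ring V)"
    using TV by (rule R.genideal_ideal)
  show "genideal (mpoly_ring V) T \<subseteq> ?K"
  proof (rule R.genideal_minimal)
    show "ideal ?K (mpoly_ring V)"
    proof (rule ideal_mpoly_ringI)
      fix p q :: "'k mpoly" assume "p \<in> ?K" "q \<in> ?K"
      then show "p + q \<in> ?K"
        using keys_add[of p q] by (blast intro: mpoly_ring_add)
    next
      fix p q :: "'k mpoly" assume *: "p \<in> carrier (mpoly_ring V)" "q \<in> ?K"
      have "\<exists>t\<in>T. \<exists>\<mu>\<in>keys t. \<exists>\<nu>. \<kappa> = \<mu> + \<nu>" if \<kappa>: "\<kappa> \<in> keys (p * q)" for \<kappa>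
      proof -
        obtain a b where "\<kappa> = a + b" "b \<in> keys q" using \<kappa> keys_mult[of p q] by blast
        moreover from this * obtain t \<mu> \<nu> where "t \<in> T" "\<mu> \<in> keys t" "b = \<mu> + \<nu>" by blast
        ultimately have "t \<in> T" "\<mu> \<in> keys t" "\<kappa> = \<mu> + (\<nu> + a)"
          by (simp_all add: ac_simps)
        then show ?thesis by blast
      qed
      then show "p * q \<in> ?K" using * by (blast intro: mpoly_ring_mult)
    qed (auto simp: mpoly_ring_0)
    show "T \<subseteq> ?K"
    proof
      fix t assume t: "t \<in> T"
      have "\<exists>\<nu>. \<kappa> = \<kappa> + \<nu>" for \<kappa> :: mon by (rule exI[of _ 0]) simp
      then show "t \<in> ?K" using t TV by blast
    qed
  qed
  show "?K \<subseteq> genideal (mpoly_ring V) T"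
  proof
    fix p assume p: "p \<in> ?K"
    have "single \<kappa> (lookup p \<kappa>) \<in> genideal (mpoly_ring V) T" if \<kappa>: "\<kappa> \<in> keys p" for \<kappa>
    proof -
      obtain t \<mu> \<nu> where t: "t \<in> T" "\<mu> \<in> keys t" "\<kappa> = \<mu> + \<nu>" using p \<kappa> by blast
      then obtain c where c: "t = single \<mu> c" "c \<noteq> 0" using T by (fastforce split: if_splits)
      have "keys \<kappa> \<subseteq> V" using p \<kappa> by (simp add: mem_mpoly_ring)
      then have "keys \<nu> \<subseteq> V" using t(3) by (simp add: keys_add_nat)
      moreover have "t \<in> genideal (mpoly_ring V) T" using TV R.genideal_self t(1) by blast
      ultimately have "single \<nu> (lookup p \<kappa> / c) * t \<in> genideal (mpoly_ring V) T"
        by (intro ideal_mpoly_mult[OF gen] mpoly_ring_single)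
      then show ?thesis using c t(3) by (simp add: mult_single add.commute)
    qed
    then show "p \<in> genideal (mpoly_ring V) T"
      by (subst sum_monomials) (rule ideal_mpoly_sum[OF gen])
  qed
qed

lemma xpow_in_genideal_terms:
  fixes T :: "'k::field mpoly set"
  assumes "\<And>t. t \<in> T \<Longrightarrow> \<exists>\<mu> c. t = single \<mu> c \<and> c \<noteq> 0 \<and> keys \<mu> \<subseteq> V"
  shows "xpow \<kappa> \<in> genideal (mpoly_ring V) T \<longleftrightarrow>
    keys \<kappa> \<subseteq> V \<and> (\<exists>t\<in>T. \<exists>\<mu>\<in>keys t. \<exists>\<nu>. \<kappa> = \<mu> + \<nu>)"
  by (simp add: genideal_terms[OF assms] xpow_in_mpoly_ring keys_xpow)

text \<open>\<open>D\<close> is the set of all monomials of the ideal. Any set of monomial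
  generators contains the minimal ones: some generator divides a given minimal m, it lies in
  \<open>D\<close>, and minimality makes it equal to m. As the minimal monomials already generate,
  an irredundant set of generators contains nothing else.\<close>

lemma min_mon_gens_eq:
  fixes D :: "mon set"
  assumes DV: "\<And>\<mu>. \<mu> \<in> D \<Longrightarrow> keys \<mu> \<subseteq> V"
    and up: "\<And>\<mu> \<nu>. \<mu> \<in> D \<Longrightarrow> keys \<nu> \<subseteq> V \<Longrightarrow> \<mu> + \<nu> \<in> D"
  shows "min_mon_gens V {p \<in> carrier (mpoly_ring V). keys (p :: 'k::field mpoly) \<subseteq> D} = minimal_mons D"
proof -
  let ?K = "{p \<in> carrier (mpoly_ring V). keys (p :: 'k mpoly) \<subseteq> D}"
  have gen: "genideal (mpoly_ring V) (xpow ` S) =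
      {p \<in> carrier (mpoly_ring V). \<forall>\<kappa>\<in>keys (p :: 'k mpoly). \<exists>\<mu>\<in>S. \<exists>\<nu>. \<kappa> = \<mu> + \<nu>}"
    if "\<And>\<mu>. \<mu> \<in> S \<Longrightarrow> keys \<mu> \<subseteq> V" for S
  proof (subst genideal_terms)
    fix t :: "'k mpoly" assume "t \<in> xpow ` S"
    then show "\<exists>\<mu> c. t = single \<mu> c \<and> c \<noteq> 0 \<and> keys \<mu> \<subseteq> V"
      using that one_neq_zero unfolding xpow_def by blast
  qed (simp add: keys_xpow)
  have minD: "\<mu> \<in> D" if "\<mu> \<in> minimal_mons D" for \<mu>
    using that by (simp add: minimal_mons_def)
  have genK: "genideal (mpoly_ring V) (xpow ` minimal_mons D) = ?K"
  proof (subst gen)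
    show "{p \<in> carrier (mpoly_ring V). \<forall>\<kappa>\<in>keys p. \<exists>\<mu>\<in>minimal_mons D. \<exists>\<nu>. \<kappa> = \<mu> + \<nu>} = ?K"
    proof (intro Collect_cong conj_cong refl)
      fix p :: "'k mpoly" assume p: "p \<in> carrier (mpoly_ring V)"
      have "(\<exists>\<mu>\<in>minimal_mons D. \<exists>\<nu>. \<kappa> = \<mu> + \<nu>) \<longleftrightarrow> \<kappa> \<in> D" if \<kappa>: "\<kappa> \<in> keys p" for \<kappa>
      proof
        assume "\<exists>\<mu>\<in>minimal_mons D. \<exists>\<nu>. \<kappa> = \<mu> + \<nu>"
        then obtain \<mu> \<nu> where *: "\<mu> \<in> minimal_mons D" "\<kappa> = \<mu> + \<nu>" by blast
        moreover have "keys \<kappa> \<subseteq> V" using p \<kappa> by (simp add: mem_mpoly_ring)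
        ultimately have "keys \<nu> \<subseteq> V" by (simp add: keys_add_nat)
        with * show "\<kappa> \<in> D" using up minD by blast
      qed (metis minimal_mons_below)
      then show "(\<forall>\<kappa>\<in>keys p. \<exists>\<mu>\<in>minimal_mons D. \<exists>\<nu>. \<kappa> = \<mu> + \<nu>) \<longleftrightarrow> keys p \<subseteq> D"
        by blast
    qed
  qed (use minD DV in blast)
  have min_sub: "minimal_mons D \<subseteq> S"
    if S: "\<And>\<mu>. \<mu> \<in> S \<Longrightarrow> keys \<mu> \<subseteq> V" "genideal (mpoly_ring V) (xpow ` S) = ?K" for S
  proof
    fix m assume m: "m \<in> minimal_mons D"
    have K: "?K = {p \<in> carrier (mpoly_ring V). \<forall>\<kappa>\<in>keys (p :: 'k mpoly). \<exists>\<mu>\<in>S. \<exists>\<nu>. \<kappa> = \<mu> + \<nu>}"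
      using gen[OF S(1)] S(2) by simp
    have "xpow m \<in> ?K" using DV minD[OF m] by (simp add: keys_xpow xpow_in_mpoly_ring)
    then obtain \<mu> \<nu> where \<mu>: "\<mu> \<in> S" "m = \<mu> + \<nu>" unfolding K by (auto simp: keys_xpow)
    \<comment> \<open>A generator belongs to the ideal it generates, and reading this through the
      description of the ideal by \<open>D\<close> gives \<mu> in \<open>D\<close>.\<close>
    have "xpow \<mu> \<in> {p \<in> carrier (mpoly_ring V). \<forall>\<kappa>\<in>keys (p :: 'k mpoly). \<exists>\<mu>\<in>S. \<exists>\<nu>. \<kappa> = \<mu> + \<nu>}"
      using \<mu>(1) S(1) by (auto simp: keys_xpow xpow_in_mpoly_ring intro!: bexI[of _ \<mu>] exI[of _ 0])
    then have "\<mu> \<in> D" unfolding K[symmetric] by (simp add: keys_xpow)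
    then have "\<mu> = m" using m \<mu>(2) unfolding minimal_mons_def by blast
    then show "m \<in> S" using \<mu>(1) by simp
  qed
  show ?thesis
    unfolding min_mon_gens_def
  proof (rule the_equality)
    show "is_min_mon_gens V ?K (minimal_mons D)"
      unfolding is_min_mon_gens_def
    proof (intro conjI ballI allI impI)
      fix S assume "S \<subset> minimal_mons D"
      then show "genideal (mpoly_ring V) (xpow ` S) \<noteq> ?K"
        using min_sub[of S] minD DV by blast
    qed (use minD DV genK in blast)+
    fix S assume S: "is_min_mon_gens V ?K S"
    then have "minimal_mons D \<subseteq> S"
      by (intro min_sub) (auto simp: is_min_mon_gens_def)
    then show "S = minimal_mons D" using S genK unfolding is_min_mon_gens_def by blast
  qed
qed

section \<open>Initial ideals and division\<close>

lemma lead_mon_single_mult: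
  fixes p :: "'k::field mpoly"
  assumes "p \<noteq> 0" "c \<noteq> 0"
  shows "lead_mon \<omega> (single \<nu> c * p) = \<nu> + lead_mon \<omega> p"
proof (rule lead_mon_unique)
  show "\<nu> + lead_mon \<omega> p \<in> keys (single \<nu> c * p)"
    using lead_mon_in_keys[OF assms(1)] assms(2) by (simp add: in_keys_iff lookup_single_mult)
  fix \<kappa> assume "\<kappa> \<in> keys (single \<nu> c * p)"
  then obtain \<kappa>' where "\<kappa> = \<nu> + \<kappa>'" "\<kappa>' \<in> keys p" using keys_single_mult by blast
  then show "\<kappa> = \<nu> + lead_mon \<omega> p \<or> wrevlex_greater \<omega> (\<nu> + lead_mon \<omega> p) \<kappa>"
    using lead_mon_greatest[OF assms(1)] by (auto simp: wrevlex_add_left)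
qed

text \<open>The bound is a monomial \<mu> fixed in advance and not the initial monomial of
  \<open>f\<close>. This makes the relation closed under sums, where initial terms may cancel, and
  meaningful for \<open>f = 0\<close>.\<close>

definition div_rep ::
    "nat set \<Rightarrow> (nat \<Rightarrow> nat) \<Rightarrow> 'k::field mpoly set \<Rightarrow> mon \<Rightarrow> 'k mpoly \<Rightarrow> bool" where
  "div_rep V \<omega> G \<mu> f \<longleftrightarrow> (\<exists>q r. r \<in> carrier (mpoly_ring V) \<and>
     (\<forall>\<kappa>\<in>keys r. \<not> wrevlex_greater \<omega> \<kappa> \<mu> \<and> (\<forall>g\<in>G. \<nexists>\<nu>. \<kappa> = lead_mon \<omega> g + \<nu>)) \<and>
     (\<forall>g\<in>G. q g \<in> carrier (mpoly_ring V) \<and> (\<forall>\<kappa>\<in>keys (q g * g). \<not> wrevlex_greater \<omega> \<kappa> \<mu>)) \<and>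
     f = (\<Sum>g\<in>G. q g * g) + r)"

lemma div_rep_0: "div_rep V \<omega> G \<mu> 0"
  unfolding div_rep_def by (intro exI[of _ "\<lambda>_. 0"] exI[of _ 0]) (simp add: mpoly_ring_0)

lemma div_rep_add:
  assumes "div_rep V \<omega> G \<mu> f" "div_rep V \<omega> G \<mu> f'"
  shows "div_rep V \<omega> G \<mu> (f + f')"
proof -
  obtain q r q' r' where
    1: "r \<in> carrier (mpoly_ring V)"
      "\<forall>\<kappa>\<in>keys r. \<not> wrevlex_greater \<omega> \<kappa> \<mu> \<and> (\<forall>g\<in>G. \<nexists>\<nu>. \<kappa> = lead_mon \<omega> g + \<nu>)"
      "\<forall>g\<in>G. q g \<in> carrier (mpoly_ring V) \<and> (\<forall>\<kappa>\<in>keys (q g * g). \<not> wrevlex_greater \<omega> \<kappa> \<mu>)"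
      "f = (\<Sum>g\<in>G. q g * g) + r" and
    2: "r' \<in> carrier (mpoly_ring V)"
      "\<forall>\<kappa>\<in>keys r'. \<not> wrevlex_greater \<omega> \<kappa> \<mu> \<and> (\<forall>g\<in>G. \<nexists>\<nu>. \<kappa> = lead_mon \<omega> g + \<nu>)"
      "\<forall>g\<in>G. q' g \<in> carrier (mpoly_ring V) \<and> (\<forall>\<kappa>\<in>keys (q' g * g). \<not> wrevlex_greater \<omega> \<kappa> \<mu>)"
      "f' = (\<Sum>g\<in>G. q' g * g) + r'"
    using assms unfolding div_rep_def by blast
  have "\<forall>\<kappa>\<in>keys (r + r'). \<not> wrevlex_greater \<omega> \<kappa> \<mu> \<and> (\<forall>g\<in>G. \<nexists>\<nu>. \<kappa> = lead_mon \<omega> g + \<nu>)"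
    using 1(2) 2(2) keys_add[of r r'] by blast
  moreover have "\<forall>g\<in>G. q g + q' g \<in> carrier (mpoly_ring V) \<and>
      (\<forall>\<kappa>\<in>keys ((q g + q' g) * g). \<not> wrevlex_greater \<omega> \<kappa> \<mu>)"
  proof (intro ballI conjI)
    fix g assume "g \<in> G"
    then show "q g + q' g \<in> carrier (mpoly_ring V)" using 1(3) 2(3) by (blast intro: mpoly_ring_add)
    fix \<kappa> assume "\<kappa> \<in> keys ((q g + q' g) * g)"
    then show "\<not> wrevlex_greater \<omega> \<kappa> \<mu>"
      using 1(3) 2(3) \<open>g \<in> G\<close> keys_add[of "q g * g" "q' g * g"] by (auto simp: distrib_right)
  qed
  ultimately show ?thesis
    unfolding div_rep_def using 1(1,4) 2(1,4)
    by (intro exI[of _ "\<lambda>g. q g + q' g"] exI[of _ "r + r'"])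
      (simp add: mpoly_ring_add distrib_right sum.distrib)
qed

text \<open>Scaling is combined with relaxing the bound from \<mu>' to \<mu>, so that
  representations of different smaller monomials can be added under one common bound.\<close>

lemma div_rep_cmult:
  assumes "div_rep V \<omega> G \<mu>' f" "\<not> wrevlex_greater \<omega> \<mu>' \<mu>"
  shows "div_rep V \<omega> G \<mu> (single 0 c * f)"
proof -
  obtain q r where
    1: "r \<in> carrier (mpoly_ring V)"
      "\<forall>\<kappa>\<in>keys r. \<not> wrevlex_greater \<omega> \<kappa> \<mu>' \<and> (\<forall>g\<in>G. \<nexists>\<nu>. \<kappa> = lead_mon \<omega> g + \<nu>)"
      "\<forall>g\<in>G. q g \<in> carrier (mpoly_ring V) \<and> (\<forall>\<kappa>\<in>keys (q g * g). \<not> wrevlex_greater \<omega> \<kappa> \<mu>')"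
      "f = (\<Sum>g\<in>G. q g * g) + r"
    using assms(1) unfolding div_rep_def by blast
  have keys: "keys (single 0 c * p) \<subseteq> keys p" for p :: "'a mpoly"
    using keys_single_mult[of 0 c p] by simp
  have le: "\<not> wrevlex_greater \<omega> \<kappa> \<mu>" if "\<not> wrevlex_greater \<omega> \<kappa> \<mu>'" for \<kappa>
    using wrevlex_not_greater_trans that assms(2) .
  have "\<forall>g\<in>G. single 0 c * q g \<in> carrier (mpoly_ring V) \<and>
      (\<forall>\<kappa>\<in>keys (single 0 c * q g * g). \<not> wrevlex_greater \<omega> \<kappa> \<mu>)"
  proof (intro ballI conjI)
    fix g assume g: "g \<in> G"
    then show "single 0 c * q g \<in> carrier (mpoly_ring V)"
      using 1(3) by (intro mpoly_ring_mult mpoly_ring_single) auto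
    fix \<kappa> assume "\<kappa> \<in> keys (single 0 c * q g * g)"
    then have "\<kappa> \<in> keys (q g * g)" using keys[of "q g * g"] by (auto simp: mult.assoc)
    then show "\<not> wrevlex_greater \<omega> \<kappa> \<mu>" using 1(3) g le by blast
  qed
  moreover have "\<forall>\<kappa>\<in>keys (single 0 c * r).
      \<not> wrevlex_greater \<omega> \<kappa> \<mu> \<and> (\<forall>g\<in>G. \<nexists>\<nu>. \<kappa> = lead_mon \<omega> g + \<nu>)"
    using 1(2) keys[of r] le by blast
  ultimately show ?thesis
    unfolding div_rep_def using 1(1,4)
    by (intro exI[of _ "\<lambda>g. single 0 c * q g"] exI[of _ "single 0 c * r"])
      (simp add: mpoly_ring_mult mpoly_ring_single distrib_left sum_distrib_left mult.assoc)
qed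

text \<open>The division algorithm as well-founded recursion on monomials: a monomial not divisible
  by any initial monomial of \<open>G\<close> is its own remainder, and any other is replaced by
  strictly smaller ones.\<close>

lemma div_rep_xpow:
  fixes G :: "'k::field mpoly set"
  assumes V: "finite V" "\<forall>i\<in>V. \<omega> i > 0"
    and G: "finite G" "G \<subseteq> carrier (mpoly_ring V)" "0 \<notin> G"
    and "keys \<mu> \<subseteq> V"
  shows "div_rep V \<omega> G \<mu> (xpow \<mu>)"
  using wf_wrevlex[OF V] assms(6)
proof (induction \<mu> rule: wf_induct_rule)
  case (less \<mu>)
  show ?case
  proof (cases "\<exists>g\<in>G. \<exists>\<nu>. \<mu> = lead_mon \<omega> g + \<nu>")
    case False
    then show ?thesis
      unfolding div_rep_def using less.prems
      by (intro exI[of _ "\<lambda>_. 0"] exI[of _ "xpow \<mu>"])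
        (simp add: mpoly_ring_0 xpow_in_mpoly_ring keys_xpow wrevlex_irrefl)
  next
    case True
    then obtain g \<nu> where g: "g \<in> G" and \<nu>: "\<mu> = \<nu> + lead_mon \<omega> g"
      by (auto simp: add.commute)
    \<comment> \<open>Dividing by the coefficient \<open>c\<close> makes the initial term of
      \<open>q * g\<close> equal to \<open>xpow \<mu>\<close>, so that it cancels in the
      difference.\<close>
    define c where "c = lookup g (lead_mon \<omega> g)"
    define q where "q = single \<nu> (1 / c)"
    have g0: "g \<noteq> 0" using G(3) g by auto
    have c: "c \<noteq> 0" using lead_mon_in_keys[OF g0, of \<omega>] by (simp add: c_def in_keys_iff)
    have \<nu>V: "keys \<nu> \<subseteq> V" using less.prems \<nu> by (simp add: keys_add_nat)
    have qg: "\<exists>\<kappa>'. \<kappa> = \<nu> + \<kappa>' \<and> (\<kappa>' = lead_mon \<omega> g \<or> wrevlex_greater \<omega> (lead_mon \<omega> g) \<kappa>')"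
      if "\<kappa> \<in> keys (q * g)" for \<kappa>
      using that keys_single_mult[of \<nu> "1 / c" g] lead_mon_greatest[OF g0, of _ \<omega>]
      unfolding q_def by blast
    have le: "\<not> wrevlex_greater \<omega> \<kappa> \<mu>" if "\<kappa> \<in> keys (q * g)" for \<kappa>
      using qg[OF that] \<nu> wrevlex_asym wrevlex_irrefl by (metis wrevlex_add_left)
    have rep1: "div_rep V \<omega> G \<mu> (q * g)"
      unfolding div_rep_def
    proof (intro exI[of _ "\<lambda>h. if h = g then q else 0"] exI[of _ 0] conjI ballI)
      show "q * g = (\<Sum>h\<in>G. (if h = g then q else 0) * h) + 0"
        using G(1) g by (simp add: if_distrib[of "\<lambda>x. x * _"] cong: if_cong)
      fix h
      show "(if h = g then q else 0) \<in> carrier (mpoly_ring V)"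
        using \<nu>V by (simp add: q_def mpoly_ring_single mpoly_ring_0)
      fix \<kappa> assume "\<kappa> \<in> keys ((if h = g then q else 0) * h)"
      then show "\<not> wrevlex_greater \<omega> \<kappa> \<mu>" using le by (auto split: if_splits)
    qed (simp_all add: mpoly_ring_0)
    define p where "p = xpow \<mu> - q * g"
    have p_less: "wrevlex_greater \<omega> \<mu> \<kappa> \<and> keys \<kappa> \<subseteq> V" if \<kappa>: "\<kappa> \<in> keys p" for \<kappa>
    proof
      have "lookup p \<mu> = 0"
        using c unfolding p_def q_def \<nu>
        by (simp add: lookup_minus lookup_single_mult xpow_def c_def)
      then have "\<kappa> \<noteq> \<mu>" using \<kappa> by (auto simp: in_keys_iff)
      then have "\<kappa> \<in> keys (q * g)"
        using \<kappa> keys_diff[of "xpow \<mu>" "q * g"] by (auto simp: p_def keys_xpow)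
      then show "wrevlex_greater \<omega> \<mu> \<kappa>"
        using qg[of \<kappa>] \<open>\<kappa> \<noteq> \<mu>\<close> \<nu> by (auto simp: wrevlex_add_left)
      have "p \<in> carrier (mpoly_ring V)"
        unfolding p_def q_def using G(2) g less.prems \<nu>V
        by (intro mpoly_ring_diff mpoly_ring_mult mpoly_ring_single) (auto simp: xpow_in_mpoly_ring)
      then show "keys \<kappa> \<subseteq> V" using \<kappa> by (simp add: mem_mpoly_ring)
    qed
    \<comment> \<open>The induction hypothesis speaks of single monomials, so what is left is
      treated term by term, all terms being smaller than \<mu>.\<close>
    have "div_rep V \<omega> G \<mu> (\<Sum>\<kappa>\<in>A. single 0 (lookup p \<kappa>) * xpow \<kappa>)" if "A \<subseteq> keys p" for A
      using finite_subset[OF that finite_keys] that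
    proof (induction A rule: finite_induct)
      case (insert \<kappa> A)
      then have "wrevlex_greater \<omega> \<mu> \<kappa>" "keys \<kappa> \<subseteq> V" using p_less by auto
      then have "div_rep V \<omega> G \<mu> (single 0 (lookup p \<kappa>) * xpow \<kappa>)"
        using less.prems by (intro div_rep_cmult[of _ _ _ \<kappa>] less.IH) (auto dest: wrevlex_asym)
      then show ?case using insert by (simp add: div_rep_add)
    qed (simp add: div_rep_0)
    from this[of "keys p"] have "div_rep V \<omega> G \<mu> p"
      by (subst sum_monomials[of p]) (simp add: xpow_def mult_single)
    from div_rep_add[OF rep1 this] show ?thesis by (simp add: p_def)
  qed
qed

section \<open>The initial ideal through its set of monomials\<close>

locale weighted_ideal =
  fixes n :: nat and \<omega> :: "nat \<Rightarrow> nat" and I :: "'k::field mpoly set"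
  assumes weights_pos: "\<forall>i\<in>{1..n}. \<omega> i > 0"
    and ideal: "ideal I (mpoly_ring {1..n})"
begin

text \<open>This set is closed under multiplication by monomials of R, so it is not merely a
  generating set but the set of all monomials of in(I).\<close>

definition leads :: "mon set" where
  "leads = {lead_mon \<omega> p |p. p \<in> I \<and> p \<noteq> 0}"

lemma I_subset: "p \<in> I \<Longrightarrow> p \<in> carrier (mpoly_ring {1..n})"
  using ideal_mpoly_subset[OF ideal] by auto

lemma lead_in_leads: "p \<in> I \<Longrightarrow> p \<noteq> 0 \<Longrightarrow> lead_mon \<omega> p \<in> leads"
  by (auto simp: leads_def)

lemma leads_keys: "\<mu> \<in> leads \<Longrightarrow> keys \<mu> \<subseteq> {1..n}"
  using I_subset lead_mon_in_keys[of _ \<omega>] by (auto simp: leads_def mem_mpoly_ring)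

lemma leads_add: "\<mu> \<in> leads \<Longrightarrow> keys \<nu> \<subseteq> {1..n} \<Longrightarrow> \<mu> + \<nu> \<in> leads"
proof -
  assume "\<mu> \<in> leads" and \<nu>: "keys \<nu> \<subseteq> {1..n}"
  then obtain p where p: "p \<in> I" "p \<noteq> 0" "\<mu> = lead_mon \<omega> p" by (auto simp: leads_def)
  have "lookup (single \<nu> 1 * p) (\<nu> + \<mu>) \<noteq> 0"
    using lead_mon_in_keys[OF p(2), of \<omega>] p(3) by (simp add: lookup_single_mult in_keys_iff)
  then have "single \<nu> 1 * p \<noteq> 0" by auto
  moreover have "single \<nu> 1 * p \<in> I"
    using \<nu> p(1) by (intro ideal_mpoly_mult[OF ideal] mpoly_ring_single)
  ultimately show "\<mu> + \<nu> \<in> leads"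
    using lead_in_leads[of "single \<nu> 1 * p"] p by (simp add: lead_mon_single_mult add.commute)
qed

text \<open>Otherwise its initial monomial would be one of its own monomials lying in in(I). Applied
  to differences, this is the source of uniqueness for reduced bases and remainders.\<close>

lemma normal_form_in_ideal: "p \<in> I \<Longrightarrow> keys p \<inter> leads = {} \<Longrightarrow> p = 0"
  using lead_in_leads[of p] lead_mon_in_keys[of p \<omega>] by blast

text \<open>Since \<open>leads\<close> is closed under multiples, divisibility by an initial
  monomial collapses to membership in \<open>leads\<close>.\<close>

lemma init_ideal_eq: "init_ideal n \<omega> I = {p \<in> carrier (mpoly_ring {1..n}). keys p \<subseteq> leads}"
proof -
  have T: "\<exists>\<mu> c. t = single \<mu> c \<and> c \<noteq> 0 \<and> keys \<mu> \<subseteq> {1..n}"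
    if t: "t \<in> {init_term \<omega> p |p. p \<in> I \<and> p \<noteq> 0}" for t
  proof -
    obtain p where p: "p \<in> I" "p \<noteq> 0" "t = init_term \<omega> p" using t by blast
    then show ?thesis
      using lead_mon_in_keys[OF p(2), of \<omega>] leads_keys[OF lead_in_leads[OF p(1,2)]]
      unfolding init_term_def in_keys_iff by blast
  qed
  have eq: "(\<exists>t\<in>{init_term \<omega> p |p. p \<in> I \<and> p \<noteq> 0}. \<exists>\<mu>\<in>keys t. \<exists>\<nu>. \<kappa> = \<mu> + \<nu>) \<longleftrightarrow> \<kappa> \<in> leads"
    if \<kappa>: "keys \<kappa> \<subseteq> {1..n}" for \<kappa>
  proof
    assume "\<exists>t\<in>{init_term \<omega> p |p. p \<in> I \<and> p \<noteq> 0}. \<exists>\<mu>\<in>keys t. \<exists>\<nu>. \<kappa> = \<mu> + \<nu>"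
    then obtain p \<nu> where "p \<in> I" "p \<noteq> 0" "\<kappa> = lead_mon \<omega> p + \<nu>"
      by (auto simp: init_term_def split: if_splits)
    then show "\<kappa> \<in> leads" using \<kappa> by (simp add: leads_add lead_in_leads keys_add_nat)
  next
    assume "\<kappa> \<in> leads"
    then obtain p where p: "p \<in> I" "p \<noteq> 0" "\<kappa> = lead_mon \<omega> p" by (auto simp: leads_def)
    then have "\<kappa> \<in> keys (init_term \<omega> p)"
      using lead_mon_in_keys[OF p(2), of \<omega>] by (simp add: init_term_def in_keys_iff)
    moreover have "\<kappa> = \<kappa> + 0" by simp
    ultimately show "\<exists>t\<in>{init_term \<omega> p |p. p \<in> I \<and> p \<noteq> 0}. \<exists>\<mu>\<in>keys t. \<exists>\<nu>. \<kappa> = \<mu> + \<nu>"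
      using p by blast
  qed
  have "init_ideal n \<omega> I = {p \<in> carrier (mpoly_ring {1..n}).
      \<forall>\<kappa>\<in>keys p. \<exists>t\<in>{init_term \<omega> p |p. p \<in> I \<and> p \<noteq> 0}. \<exists>\<mu>\<in>keys t. \<exists>\<nu>. \<kappa> = \<mu> + \<nu>}"
    unfolding init_ideal_def by (rule genideal_terms) (rule T)
  also have "\<dots> = {p \<in> carrier (mpoly_ring {1..n}). \<forall>\<kappa>\<in>keys p. \<kappa> \<in> leads}"
    by (intro Collect_cong conj_cong ball_cong refl eq) (simp add: mem_mpoly_ring)
  finally show ?thesis by (simp only: subset_iff Ball_def)
qed

lemma xpow_in_init_ideal: "xpow \<kappa> \<in> init_ideal n \<omega> I \<longleftrightarrow> \<kappa> \<in> leads"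
  using leads_keys[of \<kappa>] by (auto simp: init_ideal_eq xpow_in_mpoly_ring keys_xpow)

lemma ideal_init_ideal: "ideal (init_ideal n \<omega> I) (mpoly_ring {1..n})"
proof -
  interpret R: cring "mpoly_ring {1..n} :: 'k mpoly ring" by (rule cring_mpoly_ring)
  have "init_term \<omega> p \<in> carrier (mpoly_ring {1..n})" if "p \<in> I" "p \<noteq> 0" for p
    unfolding init_term_def using that by (intro mpoly_ring_single leads_keys lead_in_leads)
  then show ?thesis unfolding init_ideal_def by (intro R.genideal_ideal) blast
qed

lemma xpow_in_genideal_init_terms:
  assumes "H \<subseteq> I" "0 \<notin> H"
  shows "xpow \<kappa> \<in> genideal (mpoly_ring {1..n}) (init_term \<omega> ` H) \<longleftrightarrow>
    keys \<kappa> \<subseteq> {1..n} \<and> (\<exists>g\<in>H. \<exists>\<nu>. \<kappa> = lead_mon \<omega> g + \<nu>)"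
proof -
  have H: "lookup g (lead_mon \<omega> g) \<noteq> 0 \<and> keys (lead_mon \<omega> g) \<subseteq> {1..n}" if "g \<in> H" for g
  proof -
    have "g \<in> I" "g \<noteq> 0" using that assms by auto
    then show ?thesis
      using lead_mon_in_keys[of g \<omega>] leads_keys[OF lead_in_leads, of g] by (simp add: in_keys_iff)
  qed
  show ?thesis
  proof (subst xpow_in_genideal_terms)
    fix t assume "t \<in> init_term \<omega> ` H"
    then show "\<exists>\<mu> c. t = single \<mu> c \<and> c \<noteq> 0 \<and> keys \<mu> \<subseteq> {1..n}"
      using H unfolding init_term_def by blast
  next
    show "(keys \<kappa> \<subseteq> {1..n} \<and> (\<exists>t\<in>init_term \<omega> ` H. \<exists>\<mu>\<in>keys t. \<exists>\<nu>. \<kappa> = \<mu> + \<nu>)) \<longleftrightarrow>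
        keys \<kappa> \<subseteq> {1..n} \<and> (\<exists>g\<in>H. \<exists>\<nu>. \<kappa> = lead_mon \<omega> g + \<nu>)"
      using H by (simp add: init_term_def)
  qed
qed

text \<open>\<open>cover\<close> is the Groebner basis property: it turns "divisible by no initial
  monomial of G" into "no monomial in in(I)". The bound by \<mu> and the congruence modulo I are
  what the descent will use.\<close>

lemma division:
  assumes G: "finite G" "G \<subseteq> I" "0 \<notin> G"
    and cover: "\<And>\<kappa>. \<kappa> \<in> leads \<Longrightarrow> \<exists>g\<in>G. \<exists>\<nu>. \<kappa> = lead_mon \<omega> g + \<nu>"
    and \<mu>: "keys \<mu> \<subseteq> {1..n}"
  obtains r where "is_remainder n \<omega> G (xpow \<mu>) r" "r \<in> carrier (mpoly_ring {1..n})"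
    "keys r \<inter> leads = {}" "\<And>\<kappa>. \<kappa> \<in> keys r \<Longrightarrow> \<not> wrevlex_greater \<omega> \<kappa> \<mu>" "xpow \<mu> - r \<in> I"
proof -
  have "div_rep {1..n} \<omega> G \<mu> (xpow \<mu>)"
    using G(2) I_subset by (intro div_rep_xpow weights_pos G \<mu>) auto
  then obtain q r where
    r: "r \<in> carrier (mpoly_ring {1..n})"
      "\<forall>\<kappa>\<in>keys r. \<not> wrevlex_greater \<omega> \<kappa> \<mu> \<and> (\<forall>g\<in>G. \<nexists>\<nu>. \<kappa> = lead_mon \<omega> g + \<nu>)"
    and q: "\<forall>g\<in>G. q g \<in> carrier (mpoly_ring {1..n}) \<and>
        (\<forall>\<kappa>\<in>keys (q g * g). \<not> wrevlex_greater \<omega> \<kappa> \<mu>)"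
    and eq: "xpow \<mu> = (\<Sum>g\<in>G. q g * g) + r"
    unfolding div_rep_def by blast
  have "is_remainder n \<omega> G (xpow \<mu>) r"
    unfolding is_remainder_def
  proof (intro conjI exI[of _ q] ballI impI eq r(1))
    fix g assume g: "g \<in> G"
    then show "q g \<in> carrier (mpoly_ring {1..n})" using q by blast
    show "(xpow \<mu> :: 'k mpoly) \<noteq> 0" using keys_xpow[of \<mu>, where 'k='k] by auto
    assume "q g * g \<noteq> 0"
    then have "lead_mon \<omega> (q g * g) \<in> keys (q g * g)" by (rule lead_mon_in_keys)
    then have "\<not> wrevlex_greater \<omega> (lead_mon \<omega> (q g * g)) \<mu>" using q g by blast
    then show "\<not> wrevlex_greater \<omega> (lead_mon \<omega> (q g * g)) (lead_mon \<omega> (xpow \<mu> :: 'k mpoly))"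
      by (simp add: xpow_def lead_mon_single)
  qed (use r in blast)
  moreover have "keys r \<inter> leads = {}" using r(2) cover by blast
  moreover have "xpow \<mu> - r \<in> I"
    using q G(2) by (auto simp: eq intro!: ideal_mpoly_sum[OF ideal] ideal_mpoly_mult[OF ideal])
  ultimately show ?thesis using that r by blast
qed

lemma minimal_leads:
  shows finite_minimal_leads: "finite (minimal_mons leads)"
    and minimal_lead: "m \<in> minimal_mons leads \<Longrightarrow> m \<in> leads"
    and minimal_lead_dvd: "m \<in> minimal_mons leads \<Longrightarrow> m = \<mu> + \<nu> \<Longrightarrow> \<mu> \<in> leads \<Longrightarrow> \<mu> = m"
  using Dickson[of "{1..n}" leads] leads_keys by (auto simp: minimal_mons_def)

text \<open>One element of I for each minimal monomial of in(I) forms a Groebner basis, possibly not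
  reduced. It already yields normal forms, from which the reduced basis is then built.\<close>

lemma normal_form_ex:
  assumes "keys \<mu> \<subseteq> {1..n}"
  obtains r where "r \<in> carrier (mpoly_ring {1..n})" "keys r \<inter> leads = {}"
    "\<And>\<kappa>. \<kappa> \<in> keys r \<Longrightarrow> \<not> wrevlex_greater \<omega> \<kappa> \<mu>" "xpow \<mu> - r \<in> I"
proof -
  have "\<forall>m\<in>minimal_mons leads. \<exists>p. p \<in> I \<and> p \<noteq> 0 \<and> lead_mon \<omega> p = m"
    using minimal_lead unfolding leads_def by blast
  then obtain P where P: "\<And>m. m \<in> minimal_mons leads \<Longrightarrow> P m \<in> I \<and> P m \<noteq> 0 \<and> lead_mon \<omega> (P m) = m"
    by metis
  show ?thesis
  proof (rule division[of "P ` minimal_mons leads" \<mu>])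
    fix \<kappa> assume "\<kappa> \<in> leads"
    then obtain m \<nu> where "m \<in> minimal_mons leads" "\<kappa> = m + \<nu>" by (rule minimal_mons_below)
    then show "\<exists>g\<in>P ` minimal_mons leads. \<exists>\<nu>. \<kappa> = lead_mon \<omega> g + \<nu>" using P by (metis imageI)
  qed (use P finite_minimal_leads assms that in auto)
qed

section \<open>Reduced Groebner bases and remainders\<close>

lemma reduced_gb_facts:
  assumes G: "is_reduced_gb n \<omega> I G"
  shows reduced_gb_subset: "finite G" "G \<subseteq> I" "0 \<notin> G"
    and reduced_gb_cover: "\<kappa> \<in> leads \<Longrightarrow> \<exists>g\<in>G. \<exists>\<nu>. \<kappa> = lead_mon \<omega> g + \<nu>"
    and reduced_gb_monic: "g \<in> G \<Longrightarrow> lookup g (lead_mon \<omega> g) = 1"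
    and reduced_gb_reduced: "g \<in> G \<Longrightarrow> \<kappa> \<in> keys g \<Longrightarrow> g' \<in> G \<Longrightarrow> \<kappa> = lead_mon \<omega> g' + \<nu> \<Longrightarrow> g' = g"
proof -
  show G': "finite G" "G \<subseteq> I" "0 \<notin> G" using G by (auto simp: is_reduced_gb_def)
  show "\<kappa> \<in> leads \<Longrightarrow> \<exists>g\<in>G. \<exists>\<nu>. \<kappa> = lead_mon \<omega> g + \<nu>"
    using G xpow_in_genideal_init_terms[OF G'(2,3), of \<kappa>] xpow_in_init_ideal[of \<kappa>]
    unfolding is_reduced_gb_def by metis
  show "g \<in> G \<Longrightarrow> lookup g (lead_mon \<omega> g) = 1" using G by (auto simp: is_reduced_gb_def)
  show "g' = g" if *: "g \<in> G" "\<kappa> \<in> keys g" "g' \<in> G" "\<kappa> = lead_mon \<omega> g' + \<nu>"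
  proof (rule ccontr)
    assume "g' \<noteq> g"
    have "keys \<kappa> \<subseteq> {1..n}" using *(1,2) G'(2) I_subset by (auto simp: mem_mpoly_ring)
    then have "xpow \<kappa> \<in> genideal (mpoly_ring {1..n}) (init_term \<omega> ` (G - {g}))"
      using * \<open>g' \<noteq> g\<close> G' by (subst xpow_in_genideal_init_terms) auto
    then show False using G *(1,2) unfolding is_reduced_gb_def by blast
  qed
qed

text \<open>Some initial monomial of \<open>G\<close> divides \<kappa>, and reducedness forces it to
  be that of \<open>g\<close> itself. Being a multiple of the initial monomial of \<open>g\<close>
  and not larger than it, \<kappa> equals it.\<close>

lemma reduced_gb_keys:
  assumes G: "is_reduced_gb n \<omega> I G" and g: "g \<in> G" "\<kappa> \<in> keys g" "\<kappa> \<in> leads"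
  shows "\<kappa> = lead_mon \<omega> g"
proof -
  note facts = reduced_gb_facts[OF G]
  obtain g' \<nu> where g': "g' \<in> G" "\<kappa> = lead_mon \<omega> g' + \<nu>" using facts(4)[OF g(3)] by blast
  then have \<kappa>: "\<kappa> = lead_mon \<omega> g + \<nu>" using facts(6)[OF g(1,2)] by blast
  then have "keys \<nu> \<subseteq> {1..n}" using leads_keys[OF g(3)] by (simp add: keys_add_nat)
  then have "\<nu> \<noteq> 0 \<Longrightarrow> wrevlex_greater \<omega> \<kappa> (lead_mon \<omega> g)"
    unfolding \<kappa> by (intro wrevlex_add_right_pos[OF weights_pos])
  then show ?thesis using lead_mon_not_less[OF g(2)] \<kappa> by auto
qed

text \<open>One inclusion suffices by symmetry. Elements of the two bases with the same initial
  monomial differ by an element of I in normal form, because both are monic and their other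
  monomials avoid in(I).\<close>

lemma reduced_gb_unique:
  assumes G: "is_reduced_gb n \<omega> I G" and G': "is_reduced_gb n \<omega> I G'"
  shows "G \<subseteq> G'"
proof
  note facts = reduced_gb_facts[OF G] and facts' = reduced_gb_facts[OF G']
  fix g assume g: "g \<in> G"
  then have gI: "g \<in> I" "g \<noteq> 0" using facts(2,3) by auto
  obtain g' \<nu> where g': "g' \<in> G'" "lead_mon \<omega> g = lead_mon \<omega> g' + \<nu>"
    using facts'(4) lead_in_leads[OF gI] by blast
  then have g'I: "g' \<in> I" "g' \<noteq> 0" using facts'(2,3) by auto
  obtain h \<nu>' where h: "h \<in> G" "lead_mon \<omega> g' = lead_mon \<omega> h + \<nu>'"
    using facts(4) lead_in_leads[OF g'I] by blast
  \<comment> \<open>The initial monomial of \<open>h\<close> divides that of \<open>g'\<close>,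
    which divides that of \<open>g\<close>; reducedness of \<open>G\<close> leaves only
    \<open>h = g\<close>, so all three coincide.\<close>
  then have "lead_mon \<omega> g = lead_mon \<omega> h + (\<nu>' + \<nu>)" using g'(2) by (simp add: add.assoc)
  then have "h = g" by (rule facts(6)[OF g lead_mon_in_keys[OF gI(2)] h(1)])
  then have "\<nu>' + \<nu> + lead_mon \<omega> g = lead_mon \<omega> g" using h(2) g'(2) by (simp add: ac_simps)
  then have "\<nu>' + \<nu> = 0" by simp
  then have "\<nu> = 0" by (intro poly_mapping_eqI) (metis add_is_0 lookup_add lookup_zero)
  then have lead: "lead_mon \<omega> g' = lead_mon \<omega> g" using g'(2) by simp
  have "keys (g - g') \<inter> leads = {}"
  proof (rule ccontr)
    assume "keys (g - g') \<inter> leads \<noteq> {}"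
    then obtain \<kappa> where \<kappa>: "\<kappa> \<in> keys (g - g')" "\<kappa> \<in> leads" by blast
    then have "\<kappa> = lead_mon \<omega> g"
      using reduced_gb_keys[OF G g] reduced_gb_keys[OF G' g'(1)] keys_diff[of g g'] lead by auto
    then have "lookup (g - g') \<kappa> = 0"
      using facts(5)[OF g] facts'(5)[OF g'(1)] lead by (simp add: lookup_minus)
    then show False using \<kappa>(1) by (simp add: in_keys_iff)
  qed
  then have "g - g' = 0"
    using ideal_mpoly_diff[OF ideal gI(1) g'I(1)] by (intro normal_form_in_ideal)
  then show "g \<in> G'" using g'(1) by simp
qed

text \<open>The basis consists of m minus its normal form, for m a minimal monomial of in(I). The
  normal form has no monomial in in(I), so m is the initial monomial, its coefficient is 1, and no
  other term is divisible by a generator.\<close>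

lemma reduced_gb_ex: "\<exists>G. is_reduced_gb n \<omega> I G"
proof -
  let ?E = "minimal_mons leads"
  have "\<exists>r. r \<in> carrier (mpoly_ring {1..n}) \<and> keys r \<inter> leads = {} \<and>
      (\<forall>\<kappa>\<in>keys r. \<not> wrevlex_greater \<omega> \<kappa> m) \<and> xpow m - r \<in> I" if "m \<in> ?E" for m
    using normal_form_ex[OF leads_keys[OF minimal_lead[OF that]]] by metis
  then obtain r where r: "\<And>m. m \<in> ?E \<Longrightarrow> r m \<in> carrier (mpoly_ring {1..n}) \<and> keys (r m) \<inter> leads = {} \<and>
      (\<forall>\<kappa>\<in>keys (r m). \<not> wrevlex_greater \<omega> \<kappa> m) \<and> xpow m - r m \<in> I"
    by metis
  define g where "g m = xpow m - r m" for m
  have lookup_g: "lookup (g m) m = 1" if "m \<in> ?E" for m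
  proof -
    have "m \<notin> keys (r m)" using r[OF that] minimal_lead[OF that] by blast
    then show ?thesis by (simp add: g_def lookup_minus xpow_def in_keys_iff)
  qed
  have keys_g: "\<kappa> = m \<or> \<kappa> \<in> keys (r m)" if "\<kappa> \<in> keys (g m)" for m \<kappa>
    using that keys_diff[of "xpow m" "r m"] by (auto simp: g_def keys_xpow)
  have g0: "g m \<noteq> 0" if "m \<in> ?E" for m
    using lookup_g[OF that] by auto
  have lead: "lead_mon \<omega> (g m) = m" if m: "m \<in> ?E" for m
  proof (rule lead_mon_unique)
    show "m \<in> keys (g m)" using lookup_g[OF m] by (simp add: in_keys_iff)
    fix \<kappa> assume "\<kappa> \<in> keys (g m)"
    then show "\<kappa> = m \<or> wrevlex_greater \<omega> m \<kappa>"
      using keys_g[of \<kappa> m] r[OF m] wrevlex_total[of \<kappa> m \<omega>] by blast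
  qed
  have gI: "g ` ?E \<subseteq> I" "0 \<notin> g ` ?E" using r g0 by (auto simp: g_def)
  have "is_reduced_gb n \<omega> I (g ` ?E)"
    unfolding is_reduced_gb_def
  proof (intro conjI ballI)
    show "genideal (mpoly_ring {1..n}) (init_term \<omega> ` g ` ?E) = init_ideal n \<omega> I"
    proof -
      have "genideal (mpoly_ring {1..n}) (init_term \<omega> ` g ` ?E) =
          {p \<in> carrier (mpoly_ring {1..n}). \<forall>\<kappa>\<in>keys p. \<exists>m\<in>?E. \<exists>\<nu>. \<kappa> = m + \<nu>}"
      proof (subst genideal_terms)
        fix t assume "t \<in> init_term \<omega> ` g ` ?E"
        then obtain m where m: "m \<in> ?E" "t = single m 1"
          using lead lookup_g by (auto simp: init_term_def)
        then show "\<exists>\<mu> c. t = single \<mu> c \<and> c \<noteq> 0 \<and> keys \<mu> \<subseteq> {1..n}"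
          using leads_keys[OF minimal_lead] one_neq_zero by blast
      next
        show "{p \<in> carrier (mpoly_ring {1..n}). \<forall>\<kappa>\<in>keys p.
              \<exists>t\<in>init_term \<omega> ` g ` ?E. \<exists>\<mu>\<in>keys t. \<exists>\<nu>. \<kappa> = \<mu> + \<nu>} =
            {p \<in> carrier (mpoly_ring {1..n}). \<forall>\<kappa>\<in>keys p. \<exists>m\<in>?E. \<exists>\<nu>. \<kappa> = m + \<nu>}"
          using lead lookup_g by (simp add: init_term_def)
      qed
      also have "\<dots> = {p \<in> carrier (mpoly_ring {1..n}). keys p \<subseteq> leads}"
      proof -
        have "(\<exists>m\<in>?E. \<exists>\<nu>. \<kappa> = m + \<nu>) \<longleftrightarrow> \<kappa> \<in> leads" if "keys \<kappa> \<subseteq> {1..n}" for \<kappa>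
        proof
          assume "\<exists>m\<in>?E. \<exists>\<nu>. \<kappa> = m + \<nu>"
          then show "\<kappa> \<in> leads" using that leads_add minimal_lead by (auto simp: keys_add_nat)
        qed (metis minimal_mons_below)
        then show ?thesis by (intro Collect_cong conj_cong refl) (auto simp: mem_mpoly_ring)
      qed
      finally show ?thesis by (simp add: init_ideal_eq)
    qed
    fix h assume "h \<in> g ` ?E"
    then obtain m where m: "m \<in> ?E" and h: "h = g m" by blast
    then show "lookup h (lead_mon \<omega> h) = 1" using lead lookup_g by simp
    fix \<kappa> assume \<kappa>: "\<kappa> \<in> keys h"
    show "xpow \<kappa> \<notin> genideal (mpoly_ring {1..n}) (init_term \<omega> ` (g ` ?E - {h}))"
    proof
      assume "xpow \<kappa> \<in> genideal (mpoly_ring {1..n}) (init_term \<omega> ` (g ` ?E - {h}))"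
      moreover have H: "g ` ?E - {h} \<subseteq> I" "0 \<notin> g ` ?E - {h}" using gI by auto
      ultimately obtain g' \<nu>
        where g': "keys \<kappa> \<subseteq> {1..n}" "g' \<in> g ` ?E - {h}" "\<kappa> = lead_mon \<omega> g' + \<nu>"
        unfolding xpow_in_genideal_init_terms[OF H] by blast
      then obtain m' where m': "m' \<in> ?E" "g m' \<noteq> h" "\<kappa> = m' + \<nu>" using lead by auto
      then have "\<kappa> \<in> leads"
        using g'(1) leads_add minimal_lead by (simp add: keys_add_nat)
      \<comment> \<open>Among the monomials of \<open>g m\<close> only m lies in in(I), and the only
        minimal monomial dividing m is m itself.\<close>
      then have "\<kappa> = m" using keys_g[of \<kappa> m] \<kappa> h r[OF m] by blast
      then have "m' = m"
        using m' minimal_lead_dvd[OF m, of m' \<nu>] minimal_lead by simp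
      then show False using m'(2) h by simp
    qed
  qed (use gI finite_minimal_leads in auto)
  then show ?thesis ..
qed

lemma is_reduced_gb_reduced_gb: "is_reduced_gb n \<omega> I (reduced_gb n \<omega> I)"
proof -
  obtain G where G: "is_reduced_gb n \<omega> I G" using reduced_gb_ex by blast
  then have "reduced_gb n \<omega> I = G"
    unfolding reduced_gb_def using reduced_gb_unique by (intro the_equality) blast+
  with G show ?thesis by simp
qed

text \<open>Two remainders of the same monomial differ by an element of I in normal form, hence
  agree; the description therefore selects the one produced by \<open>division\<close>.\<close>

lemma remainder_xpow:
  fixes \<mu> :: mon
  defines "r \<equiv> remainder n \<omega> (reduced_gb n \<omega> I) (xpow \<mu>)"
  assumes "keys \<mu> \<subseteq> {1..n}"
  shows "r \<in> carrier (mpoly_ring {1..n})" "keys r \<inter> leads = {}"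
    "\<And>\<kappa>. \<kappa> \<in> keys r \<Longrightarrow> \<not> wrevlex_greater \<omega> \<kappa> \<mu>" "xpow \<mu> - r \<in> I"
proof -
  let ?G = "reduced_gb n \<omega> I"
  note facts = reduced_gb_facts[OF is_reduced_gb_reduced_gb]
  obtain s where s: "is_remainder n \<omega> ?G (xpow \<mu>) s" "s \<in> carrier (mpoly_ring {1..n})"
    "keys s \<inter> leads = {}" "\<And>\<kappa>. \<kappa> \<in> keys s \<Longrightarrow> \<not> wrevlex_greater \<omega> \<kappa> \<mu>" "xpow \<mu> - s \<in> I"
    using division[OF facts(1-4) assms(2)] by blast
  have "t = s" if t: "is_remainder n \<omega> ?G (xpow \<mu>) t" for t
  proof -
    obtain q where q: "\<forall>g\<in>?G. q g \<in> carrier (mpoly_ring {1..n})" "xpow \<mu> = (\<Sum>g\<in>?G. q g * g) + t"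
      using t unfolding is_remainder_def by blast
    have "xpow \<mu> - t \<in> I"
      using q facts(2) by (auto intro!: ideal_mpoly_sum[OF ideal] ideal_mpoly_mult[OF ideal])
    then have "t - s \<in> I" using ideal_mpoly_diff[OF ideal s(5)] by fastforce
    moreover have "keys t \<inter> leads = {}"
      using t facts(4) unfolding is_remainder_def by blast
    then have "keys (t - s) \<inter> leads = {}" using s(3) keys_diff[of t s] by blast
    ultimately show "t = s" using normal_form_in_ideal by fastforce
  qed
  then have "r = s" unfolding r_def remainder_def using s(1) by (intro the_equality)
  then show "r \<in> carrier (mpoly_ring {1..n})" "keys r \<inter> leads = {}"
    "\<And>\<kappa>. \<kappa> \<in> keys r \<Longrightarrow> \<not> wrevlex_greater \<omega> \<kappa> \<mu>" "xpow \<mu> - r \<in> I"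
    using s by auto
qed

end

section \<open>The free module and its map to the polynomial ring\<close>

lemma free_module_simps [simp]:
  "zero (free_module V B) = 0" "add (free_module V B) = (+)"
  "smult (free_module V B) a F = Poly_Mapping.map ((*) a) F"
  by (simp_all add: free_module_def)

lemma mem_free_module: "F \<in> carrier (free_module V B) \<longleftrightarrow>
    keys F \<subseteq> B \<and> (\<forall>v. lookup F v \<in> carrier (mpoly_ring V))"
  by (simp add: free_module_def)

lemma lookup_smult: "lookup (Poly_Mapping.map ((*) a) F) v = a * lookup F v"
  for a :: "'k::comm_ring_1 mpoly"
  by (simp add: Poly_Mapping.map.rep_eq when_def)

lemma keys_smult: "keys (Poly_Mapping.map ((*) a) F) \<subseteq> keys F"
  for a :: "'k::comm_ring_1 mpoly"
  by (auto simp: in_keys_iff lookup_smult)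

lemma free_module_0: "0 \<in> carrier (free_module V B)"
  by (simp add: mem_free_module mpoly_ring_0)

lemma free_module_add: "F \<in> carrier (free_module V B) \<Longrightarrow> G \<in> carrier (free_module V B) \<Longrightarrow>
    F + G \<in> carrier (free_module V B)"
  using keys_add[of F G] by (auto simp: mem_free_module lookup_add mpoly_ring_add)

lemma free_module_uminus: "F \<in> carrier (free_module V B) \<Longrightarrow> - F \<in> carrier (free_module V B)"
  by (auto simp: mem_free_module mpoly_ring_uminus in_keys_iff)

lemma free_module_diff: "F \<in> carrier (free_module V B) \<Longrightarrow> G \<in> carrier (free_module V B) \<Longrightarrow>
    F - G \<in> carrier (free_module V B)"
  using free_module_add[of F V B "- G"] free_module_uminus[of G V B] by simp

lemma free_module_smult: "a \<in> carrier (mpoly_ring V) \<Longrightarrow> F \<in> carrier (free_module V B) \<Longrightarrow>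
    Poly_Mapping.map ((*) a) F \<in> carrier (free_module V B)"
  using keys_smult[of a F] by (auto simp: mem_free_module lookup_smult mpoly_ring_mult)

lemma free_module_single: "v \<in> B \<Longrightarrow> p \<in> carrier (mpoly_ring V) \<Longrightarrow>
    single v p \<in> carrier (free_module V B)"
  by (auto simp: mem_free_module lookup_single when_def mpoly_ring_0)

lemma free_module_sum: "(\<And>i. i \<in> A \<Longrightarrow> f i \<in> carrier (free_module V B)) \<Longrightarrow>
    sum f A \<in> carrier (free_module V B)"
  by (induction A rule: infinite_finite_induct) (simp_all add: free_module_0 free_module_add)

lemma submodule_free_moduleI:
  fixes N :: "(mon \<Rightarrow>\<^sub>0 'k::comm_ring_1 mpoly) set"
  assumes "N \<subseteq> carrier (free_module V B)" "0 \<in> N"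
    and add: "\<And>F G. F \<in> N \<Longrightarrow> G \<in> N \<Longrightarrow> F + G \<in> N"
    and smult: "\<And>a F. a \<in> carrier (mpoly_ring V) \<Longrightarrow> F \<in> N \<Longrightarrow> Poly_Mapping.map ((*) a) F \<in> N"
  shows "submodule N (mpoly_ring V) (free_module V B)"
proof -
  interpret M: abelian_group "free_module V B :: ('k mpoly, mon \<Rightarrow>\<^sub>0 'k mpoly) module"
  proof (rule abelian_groupI)
    fix F :: "mon \<Rightarrow>\<^sub>0 'k mpoly" assume "F \<in> carrier (free_module V B)"
    then show "\<exists>G\<in>carrier (free_module V B). G \<oplus>\<^bsub>free_module V B\<^esub> F = \<zero>\<^bsub>free_module V B\<^esub>"
      by (intro bexI[of _ "- F"]) (simp_all add: free_module_uminus)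
  qed (simp_all add: free_module_0 free_module_add ac_simps)
  show ?thesis
  proof (intro submodule.intro submodule_axioms.intro M.add.subgroupI)
    fix F assume F: "F \<in> N"
    then have "\<ominus>\<^bsub>free_module V B\<^esub> F = - F"
      using assms(1) free_module_uminus[of F V B] by (intro M.minus_equality) auto
    moreover have "- F = Poly_Mapping.map ((*) (- 1)) F"
      by (rule poly_mapping_eqI) (simp add: lookup_smult)
    moreover have "Poly_Mapping.map ((*) (- 1)) F \<in> N"
      using F by (intro smult mpoly_ring_uminus mpoly_ring_1)
    ultimately show "\<ominus>\<^bsub>free_module V B\<^esub> F \<in> N" by simp
  qed (use assms in auto)
qed

lemma
  assumes "submodule N (mpoly_ring V) (free_module V B)"
  shows submodule_free_module_0: "0 \<in> N"
    and submodule_free_module_add: "F \<in> N \<Longrightarrow> G \<in> N \<Longrightarrow> F + G \<in> N"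
    and submodule_free_module_smult:
      "a \<in> carrier (mpoly_ring V) \<Longrightarrow> F \<in> N \<Longrightarrow> Poly_Mapping.map ((*) a) F \<in> N"
proof -
  have sub: "subgroup N (add_monoid (free_module V B))" using assms by (rule submodule.axioms)
  show "0 \<in> N" using subgroup.one_closed[OF sub] by simp
  show "F + G \<in> N" if "F \<in> N" "G \<in> N" using subgroup.m_closed[OF sub that] by simp
  show "Poly_Mapping.map ((*) a) F \<in> N" if "a \<in> carrier (mpoly_ring V)" "F \<in> N"
    using submodule.smult_closed[OF assms that] by simp
qed

section \<open>The A-linear map from the free module to R sending \<epsilon>_v to v\<close>

lemma combine_superset:
  "finite S \<Longrightarrow> keys F \<subseteq> S \<Longrightarrow> combine F = (\<Sum>v\<in>S. lookup F v * xpow v)"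
  unfolding combine_def by (intro sum.mono_neutral_left) (auto simp: in_keys_iff)

lemma combine_add: "combine (F + G) = combine F + combine G"
  using combine_superset[of "keys F \<union> keys G" F] combine_superset[of "keys F \<union> keys G" G]
    combine_superset[of "keys F \<union> keys G" "F + G"] keys_add[of F G]
  by (simp add: lookup_add distrib_right sum.distrib)

lemma combine_0: "combine 0 = 0"
  by (simp add: combine_def)

lemma combine_diff: "combine (F - G) = combine F - combine G"
  using combine_add[of "F - G" G] by (simp add: algebra_simps)

lemma combine_sum: "combine (sum f A) = (\<Sum>i\<in>A. combine (f i))"
  by (induction A rule: infinite_finite_induct) (simp_all add: combine_0 combine_add)

lemma combine_smult: "combine (Poly_Mapping.map ((*) a) F) = a * combine F"
  using combine_superset[OF finite_keys keys_smult[of a F]]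
  by (simp add: lookup_smult combine_def[of F] sum_distrib_left mult.assoc)

lemma combine_single: "combine (single v p) = p * xpow v"
  by (simp add: combine_def)

lemma keys_combine:
  assumes "\<kappa> \<in> keys (combine F)"
  obtains v M where "v \<in> keys F" "M \<in> keys (lookup F v)" "\<kappa> = v + M"
proof -
  have "(\<Sum>v\<in>keys F. lookup (lookup F v * xpow v) \<kappa>) \<noteq> 0"
    using assms by (simp add: in_keys_iff combine_def lookup_sum)
  then obtain v where v: "v \<in> keys F" "lookup (lookup F v * xpow v) \<kappa> \<noteq> 0"
    by (rule sum.not_neutral_contains_not_neutral)
  then have "\<kappa> \<in> keys (single v 1 * lookup F v)"
    by (simp add: in_keys_iff xpow_def mult.commute[of "single v 1"])
  then obtain M where "M \<in> keys (lookup F v)" "\<kappa> = v + M"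
    using keys_single_mult[of v 1 "lookup F v"] by blast
  then show ?thesis by (rule that[OF v(1)])
qed

lemma combine_in_mpoly_ring:
  assumes "F \<in> carrier (free_module W B)" "W \<subseteq> V" "\<And>v. v \<in> B \<Longrightarrow> keys v \<subseteq> V"
  shows "combine F \<in> carrier (mpoly_ring V)"
  unfolding combine_def
  using assms by (intro mpoly_ring_sum mpoly_ring_mult)
    (auto simp: xpow_in_mpoly_ring mem_free_module intro: mpoly_ring_mono[OF assms(2)])

text \<open>By unique splitting, a product with an index \<open>w\<close> other than
  \<open>v\<close> never yields the monomial \<open>v + M\<close>, so only the summand of
  \<open>v\<close> contributes.\<close>

lemma lookup_combine:
  assumes F: "F \<in> carrier (free_module W B)" and B: "\<And>v. v \<in> B \<Longrightarrow> keys v \<inter> W = {}"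
    and v: "v \<in> B" and M: "keys M \<subseteq> W"
  shows "lookup (combine F) (v + M) = lookup (lookup F v) M"
proof -
  have 0: "lookup (lookup F w * xpow w) (v + M) = 0" if "w \<in> B" "w \<noteq> v" for w
  proof (rule ccontr)
    assume "lookup (lookup F w * xpow w) (v + M) \<noteq> 0"
    then have "v + M \<in> keys (single w 1 * lookup F w)"
      by (simp add: in_keys_iff xpow_def mult.commute)
    then obtain N where N: "v + M = w + N" "N \<in> keys (lookup F w)" 
      using keys_single_mult[of w 1 "lookup F w"] by blast
    then have "keys N \<subseteq> W" using F by (auto simp: mem_free_module mem_mpoly_ring)
    then show False using mon_split_unique[OF N(1) B[OF v] B[OF that(1)] M] that(2) by blast
  qed
  have "lookup (combine F) (v + M) = (\<Sum>w\<in>insert v (keys F). lookup (lookup F w * xpow w) (v + M))"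
    by (subst combine_superset[of "insert v (keys F)"]) (auto simp: lookup_sum)
  also have "\<dots> = (\<Sum>w\<in>{v}. lookup (lookup F w * xpow w) (v + M))"
    using F 0 by (intro sum.mono_neutral_right) (auto simp: mem_free_module)
  also have "\<dots> = lookup (lookup F v) M"
    by (simp add: xpow_def mult.commute[of _ "single v 1"] lookup_single_mult)
  finally show ?thesis .
qed

text \<open>Every coefficient of every component reappears as a coefficient of the image, so the map
  is injective.\<close>

lemma combine_eq_0:
  assumes "F \<in> carrier (free_module W B)" "\<And>v. v \<in> B \<Longrightarrow> keys v \<inter> W = {}" "combine F = 0"
  shows "F = 0"
proof (intro poly_mapping_eqI)
  fix v M
  show "lookup (lookup F v) M = lookup (lookup 0 v) M"
  proof (cases "v \<in> keys F \<and> M \<in> keys (lookup F v)")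
    case True
    then have "v \<in> B" "keys M \<subseteq> W" using assms(1) by (auto simp: mem_free_module mem_mpoly_ring)
    then show ?thesis using lookup_combine[OF assms(1,2), of v M] assms(3) by simp
  qed (auto simp: in_keys_iff)
qed

lemma combine_surj:
  assumes "\<And>\<kappa>. \<kappa> \<in> keys r \<Longrightarrow> \<exists>v\<in>B. \<exists>M. keys M \<subseteq> W \<and> \<kappa> = v + M"
  obtains F where "F \<in> carrier (free_module W B)" "combine F = r"
proof -
  from assms obtain v M where vM: "\<And>\<kappa>. \<kappa> \<in> keys r \<Longrightarrow> v \<kappa> \<in> B \<and> keys (M \<kappa>) \<subseteq> W \<and> \<kappa> = v \<kappa> + M \<kappa>"
    by metis
  \<comment> \<open>Each term of \<open>r\<close> is lifted separately: its factor from A and its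
    coefficient go to the component indexed by its factor in \<open>B\<close>.\<close>
  let ?F = "\<Sum>\<kappa>\<in>keys r. single (v \<kappa>) (single (M \<kappa>) (lookup r \<kappa>))"
  have "?F \<in> carrier (free_module W B)"
    using vM by (intro free_module_sum free_module_single mpoly_ring_single) auto
  moreover have "combine ?F = (\<Sum>\<kappa>\<in>keys r. single \<kappa> (lookup r \<kappa>))"
    unfolding combine_sum combine_single
    using vM by (intro sum.cong refl) (simp add: xpow_def mult_single add.commute)
  ultimately show ?thesis using that by (simp add: sum_monomials[symmetric])
qed

section \<open>Setting the variables of A equal to 1\<close>

lemma xpow_sum: "(\<Prod>i\<in>A. xpow (f i)) = (xpow (sum f A) :: 'k::comm_ring_1 mpoly)"
  by (induction A rule: infinite_finite_induct) (simp_all add: xpow_mult, simp_all add: xpow_def)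

lemma Var_power: "Var i ^ k = (xpow (single i k) :: 'k::comm_ring_1 mpoly)"
proof (induction k)
  case (Suc k)
  have "Var i ^ Suc k = (xpow (single i 1 + single i k) :: 'k mpoly)"
    by (simp add: Suc.IH) (simp add: Var_def xpow_mult)
  then show ?case by (simp add: single_add[symmetric])
qed (simp add: xpow_def)

lemma \<chi>_xpow:
  assumes "keys u \<inter> {n - d + 1..n} = {}" "keys M \<subseteq> {n - d + 1..n}"
  shows "\<chi> n d (xpow (u + M)) = (xpow u :: 'k::comm_ring_1 mpoly)"
proof -
  let ?W = "{n - d + 1..n}"
  have "\<chi> n d (xpow (u + M)) =
      (\<Prod>i\<in>keys (u + M). (if i \<in> ?W then 1 else Var i :: 'k mpoly) ^ lookup (u + M) i)"
    unfolding \<chi>_def subst_poly_def by (simp add: keys_xpow xpow_def)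
  \<comment> \<open>Indices that occur only in \<open>M\<close> contribute powers of 1.\<close>
  also have "\<dots> = (\<Prod>i\<in>keys u. (if i \<in> ?W then 1 else Var i) ^ lookup (u + M) i)"
    using assms by (intro prod.mono_neutral_right) (auto simp: keys_add_nat)
  also have "\<dots> = (\<Prod>i\<in>keys u. xpow (single i (lookup u i)))"
  proof (intro prod.cong refl)
    fix i assume "i \<in> keys u"
    then have "i \<notin> ?W" using assms(1) by blast
    moreover from this have "lookup M i = 0" using assms(2) by (meson in_keys_iff subsetD)
    ultimately show "(if i \<in> ?W then 1 else Var i :: 'k mpoly) ^ lookup (u + M) i = xpow (single i (lookup u i))"
      by (auto simp: Var_power lookup_add)
  qed
  also have "\<dots> = xpow u" by (simp add: xpow_sum sum_monomials[symmetric])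
  finally show ?thesis .
qed

lemma set_add_mpoly_ring: "A <+>\<^bsub>mpoly_ring V\<^esub> B = {a + b |a b. a \<in> A \<and> b \<in> B}"
  by (auto simp: set_add_defs)

section \<open>The kernel\<close>

context weighted_ideal
begin

text \<open>A monomial in a sum of two monomial ideals occurs in one of the two summands and so lies
  in one of the two ideals; the ideal of the variables of A contains exactly the monomials of R that
  involve such a variable.\<close>

lemma B0_iff: "v \<in> B0 n d \<omega> I \<longleftrightarrow>
    keys v \<subseteq> {1..n} \<and> keys v \<inter> {n - d + 1..n} = {} \<and> v \<notin> leads"
proof -
  let ?W = "{n - d + 1..n}" and ?L = "genideal (mpoly_ring {1..n}) (Var ` {n - d + 1..n}) :: 'k mpoly set"
  have L: "?L = {p \<in> carrier (mpoly_ring {1..n}).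
      \<forall>\<kappa>\<in>keys p. \<exists>t\<in>Var ` ?W. \<exists>\<mu>\<in>keys (t :: 'k mpoly). \<exists>\<nu>. \<kappa> = \<mu> + \<nu>}"
  proof (rule genideal_terms)
    fix t :: "'k mpoly" assume "t \<in> Var ` ?W"
    then obtain i where "i \<in> ?W" "t = single (single i 1) 1" by (auto simp: Var_def xpow_def)
    moreover from this have "keys (single i (1::nat)) \<subseteq> {1..n}" by auto
    ultimately show "\<exists>\<mu> c. t = single \<mu> c \<and> c \<noteq> 0 \<and> keys \<mu> \<subseteq> {1..n}"
      using one_neq_zero by blast
  qed
  have dvd: "(\<exists>\<nu>. \<kappa> = single i (Suc 0) + \<nu>) \<longleftrightarrow> i \<in> keys \<kappa>" for \<kappa> :: mon and i
    unfolding mon_dvd_iff by (auto simp: lookup_single when_def in_keys_iff)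
  have L': "?L = {p \<in> carrier (mpoly_ring {1..n}). \<forall>\<kappa>\<in>keys p. keys \<kappa> \<inter> ?W \<noteq> {}}"
    unfolding L using dvd by (auto simp: Var_def keys_xpow)
  have "xpow v \<in> init_ideal n \<omega> I <+>\<^bsub>mpoly_ring {1..n}\<^esub> ?L \<longleftrightarrow> v \<in> leads \<or> keys v \<inter> ?W \<noteq> {}"
    if v: "keys v \<subseteq> {1..n}"
  proof
    assume "xpow v \<in> init_ideal n \<omega> I <+>\<^bsub>mpoly_ring {1..n}\<^esub> ?L"
    then obtain a b where ab: "a \<in> init_ideal n \<omega> I" "b \<in> ?L" "xpow v = a + b"
      unfolding set_add_mpoly_ring by blast
    have "v \<in> keys a \<or> v \<in> keys b"
      using keys_add[of a b] keys_xpow[of v, where 'k='k] ab(3) by auto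
    then show "v \<in> leads \<or> keys v \<inter> ?W \<noteq> {}"
      using ab(1,2) unfolding init_ideal_eq L' by auto
  next
    assume "v \<in> leads \<or> keys v \<inter> ?W \<noteq> {}"
    then show "xpow v \<in> init_ideal n \<omega> I <+>\<^bsub>mpoly_ring {1..n}\<^esub> ?L"
    proof
      assume "v \<in> leads"
      then have "xpow v \<in> init_ideal n \<omega> I" by (simp add: xpow_in_init_ideal)
      moreover have "(0 :: 'k mpoly) \<in> ?L" unfolding L' by (simp add: mpoly_ring_0)
      ultimately show ?thesis
        unfolding set_add_mpoly_ring by (intro CollectI exI[of _ "xpow v"] exI[of _ 0]) simp
    next
      assume "keys v \<inter> ?W \<noteq> {}"
      then have "xpow v \<in> ?L" using v unfolding L' by (simp add: xpow_in_mpoly_ring keys_xpow)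
      moreover have "0 \<in> init_ideal n \<omega> I" by (rule ideal_mpoly_0[OF ideal_init_ideal])
      ultimately show ?thesis
        unfolding set_add_mpoly_ring by (intro CollectI exI[of _ 0] exI[of _ "xpow v"]) simp
    qed
  qed
  then show ?thesis unfolding B0_def by auto
qed

lemma B0_disjoint: "v \<in> B0 n d \<omega> I \<Longrightarrow> keys v \<inter> {n - d + 1..n} = {}"
  by (simp add: B0_iff)

lemma mon_in_B0_split:
  assumes "keys \<kappa> \<subseteq> {1..n}" "\<kappa> \<notin> leads"
  obtains v M where "v \<in> B0 n d \<omega> I" "keys M \<subseteq> {n - d + 1..n}" "\<kappa> = v + M"
proof -
  obtain v M where vM: "\<kappa> = v + M" "keys v \<inter> {n - d + 1..n} = {}" "keys M \<subseteq> {n - d + 1..n}"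
    by (rule mon_split)
  then have "keys v \<subseteq> {1..n}" "keys M \<subseteq> {1..n}" using assms(1) by (auto simp: keys_add_nat)
  \<comment> \<open>A factor in in(I) would put the whole product into in(I).\<close>
  moreover from this have "v \<notin> leads" using vM(1) assms(2) leads_add[of v M] by auto
  ultimately have "v \<in> B0 n d \<omega> I" unfolding B0_iff using vM(2) by blast
  then show ?thesis using vM(3,1) by (rule that)
qed

text \<open>The monomials of the remainder avoid in(I), so each splits with a factor in B0, which
  gives existence; uniqueness is injectivity of \<open>combine\<close>.\<close>

lemma f_coeffs:
  assumes "keys \<alpha> \<subseteq> {1..n}"
  shows "f_coeffs n d \<omega> I \<alpha> \<in> carrier (F0 n d \<omega> I)"
    "combine (f_coeffs n d \<omega> I \<alpha>) = remainder n \<omega> (reduced_gb n \<omega> I) (xpow \<alpha>)"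
proof -
  let ?r = "remainder n \<omega> (reduced_gb n \<omega> I) (xpow \<alpha>)"
  have "\<exists>v\<in>B0 n d \<omega> I. \<exists>M. keys M \<subseteq> {n - d + 1..n} \<and> \<kappa> = v + M" if "\<kappa> \<in> keys ?r" for \<kappa>
  proof -
    have "keys \<kappa> \<subseteq> {1..n}" "\<kappa> \<notin> leads"
      using that remainder_xpow(1,2)[OF assms] by (auto simp: mem_mpoly_ring)
    then show ?thesis by (rule mon_in_B0_split[of \<kappa> d]) blast
  qed
  then obtain F where F: "F \<in> carrier (F0 n d \<omega> I)" "combine F = ?r"
    unfolding F0_def by (rule combine_surj)
  have "f_coeffs n d \<omega> I \<alpha> = F"
    unfolding f_coeffs_def
  proof (rule the_equality)
    fix G assume G: "G \<in> carrier (F0 n d \<omega> I) \<and> combine G = ?r"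
    then have "G - F \<in> carrier (F0 n d \<omega> I)" "combine (G - F) = 0"
      using F by (simp_all add: F0_def free_module_diff combine_diff)
    then have "G - F = 0"
      using combine_eq_0[of "G - F" "{n - d + 1..n}" "B0 n d \<omega> I"] B0_disjoint
      unfolding F0_def by blast
    then show "G = F" by simp
  qed (use F in simp)
  with F show "f_coeffs n d \<omega> I \<alpha> \<in> carrier (F0 n d \<omega> I)" "combine (f_coeffs n d \<omega> I \<alpha>) = ?r"
    by auto
qed

text \<open>The two descriptions are resolved here: \<open>\<chi>\<close> recovers \<open>u\<close>
  from the product, and cancellation recovers \<open>M\<close>.\<close>

lemma h_elem_eq:
  assumes "u \<in> B0 n d \<omega> I" "keys M \<subseteq> {n - d + 1..n}"
  shows "h_elem n d \<omega> I (u + M) = single u (xpow M) - f_coeffs n d \<omega> I (u + M)"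
proof -
  have \<chi>: "\<chi> n d (xpow (u + M)) = (xpow u :: 'k mpoly)"
    using assms B0_disjoint by (intro \<chi>_xpow)
  have "(THE u'. (xpow u' :: 'k mpoly) = \<chi> n d (xpow (u + M))) = u"
    unfolding \<chi> by (intro the_equality inj_xpow[where 'k='k]) auto
  moreover have "(THE M'. u + M = u + M') = M" by (intro the_equality) auto
  ultimately show ?thesis unfolding h_elem_def Let_def by simp
qed

lemma h_elem:
  assumes "u \<in> B0 n d \<omega> I" "keys M \<subseteq> {n - d + 1..n}"
  shows "h_elem n d \<omega> I (u + M) \<in> carrier (F0 n d \<omega> I)"
    "combine (h_elem n d \<omega> I (u + M)) =
      xpow (u + M) - remainder n \<omega> (reduced_gb n \<omega> I) (xpow (u + M))"
proof -
  have "keys M \<subseteq> {1..n}" using assms(2) by force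
  then have "keys (u + M) \<subseteq> {1..n}" using assms(1) by (simp add: keys_add_nat B0_iff)
  note f = f_coeffs[OF this, of d]
  show "h_elem n d \<omega> I (u + M) \<in> carrier (F0 n d \<omega> I)"
    unfolding h_elem_eq[OF assms] using f(1) assms unfolding F0_def
    by (intro free_module_diff free_module_single) (simp_all add: xpow_in_mpoly_ring)
  show "combine (h_elem n d \<omega> I (u + M)) =
      xpow (u + M) - remainder n \<omega> (reduced_gb n \<omega> I) (xpow (u + M))"
    unfolding h_elem_eq[OF assms] combine_diff combine_single f(2) by (simp add: xpow_mult add.commute)
qed

text \<open>These are the monomials of the colon ideal I_u, expressed through
  \<open>leads\<close>.\<close>

definition colon_mons :: "nat \<Rightarrow> mon \<Rightarrow> mon set" where
  "colon_mons d u = {M. keys M \<subseteq> {n - d + 1..n} \<and> u + M \<in> leads}"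

text \<open>Multiplying by \<open>xpow u\<close> only shifts the monomials of \<open>p\<close>, so
  the product lies in in(I) exactly when every shifted monomial does.\<close>

lemma min_mon_gens_I_colon:
  assumes "keys u \<subseteq> {1..n}"
  shows "min_mon_gens {n - d + 1..n} (I_colon n d \<omega> I u) = minimal_mons (colon_mons d u)"
proof -
  let ?W = "{n - d + 1..n}"
  have W: "?W \<subseteq> {1..n}" by auto
  have "p * xpow u \<in> init_ideal n \<omega> I \<longleftrightarrow> keys p \<subseteq> colon_mons d u"
    if p: "p \<in> carrier (mpoly_ring ?W)" for p
  proof -
    have "p * xpow u \<in> carrier (mpoly_ring {1..n})"
      using assms mpoly_ring_mono[OF W p] by (intro mpoly_ring_mult) (simp_all add: xpow_in_mpoly_ring)
    moreover have "keys (p * xpow u) = (+) u ` keys p"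
    proof
      show "keys (p * xpow u) \<subseteq> (+) u ` keys p"
        using keys_single_mult[of u 1 p] by (simp add: xpow_def mult.commute)
      show "(+) u ` keys p \<subseteq> keys (p * xpow u)"
        by (auto simp: xpow_def mult.commute[of p] in_keys_iff lookup_single_mult)
    qed
    ultimately show ?thesis
      using p by (auto simp: init_ideal_eq colon_mons_def mem_mpoly_ring)
  qed
  then have "I_colon n d \<omega> I u = {p \<in> carrier (mpoly_ring ?W). keys p \<subseteq> colon_mons d u}"
    unfolding I_colon_def using mpoly_ring_mono[OF W] by auto
  moreover have "min_mon_gens ?W {p \<in> carrier (mpoly_ring ?W). keys (p :: 'k mpoly) \<subseteq> colon_mons d u} =
      minimal_mons (colon_mons d u)"
  proof (rule min_mon_gens_eq)
    fix \<mu> \<nu> :: mon assume "\<mu> \<in> colon_mons d u" "keys \<nu> \<subseteq> ?W"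
    moreover from this W have "keys \<nu> \<subseteq> {1..n}" by blast
    ultimately have "u + \<mu> + \<nu> \<in> leads" "keys (\<mu> + \<nu>) \<subseteq> ?W"
      using leads_add[of "u + \<mu>" \<nu>] by (simp_all add: colon_mons_def keys_add_nat)
    then show "\<mu> + \<nu> \<in> colon_mons d u" by (simp add: colon_mons_def add.assoc)
  qed (simp add: colon_mons_def)
  ultimately show ?thesis by simp
qed

text \<open>The condition \<open>u \<in> J\<close> is automatic once \<open>I_u\<close> is nonzero.\<close>

lemma xpow_in_J:
  assumes "keys u \<inter> {n - d + 1..n} = {}" "M \<in> colon_mons d u"
  shows "xpow u \<in> J_ideal n d \<omega> I"
proof -
  have "xpow (u + M) \<in> init_ideal n \<omega> I" using assms(2) by (simp add: xpow_in_init_ideal colon_mons_def)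
  then have "\<chi> n d (xpow (u + M)) \<in> \<chi> n d ` init_ideal n \<omega> I" by (rule imageI)
  then have "\<chi> n d (xpow (u + M)) \<in> J_ideal n d \<omega> I"
    unfolding J_ideal_def genideal_def by blast
  then show ?thesis using assms by (simp add: \<chi>_xpow colon_mons_def)
qed

lemma B1'_eq: "B1' n d \<omega> I = {u + M |u M. u \<in> B0 n d \<omega> I \<and> M \<in> minimal_mons (colon_mons d u)}"
proof -
  have eq: "xpow u \<in> J_ideal n d \<omega> I \<and> M \<in> min_mon_gens {n - d + 1..n} (I_colon n d \<omega> I u) \<longleftrightarrow>
      M \<in> minimal_mons (colon_mons d u)" if "u \<in> B0 n d \<omega> I" for u M
    using that min_mon_gens_I_colon[of u d] xpow_in_J[of u d M] by (auto simp: B0_iff minimal_mons_def)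
  show ?thesis
    unfolding B1'_def
    by (intro Collect_cong ex_cong1) (rule conj_cong[OF refl], rule conj_cong[OF refl], rule eq)
qed

text \<open>The zero of the quotient is I itself, and a coset of I equals I exactly when its
  representative lies in I.\<close>

lemma a_kernel_eq: "a_kernel (F0 n d \<omega> I) (mpoly_ring {1..n} Quot I) (\<psi>0 n I) =
    {F \<in> carrier (F0 n d \<omega> I). combine F \<in> I}"
proof -
  interpret ideal I "mpoly_ring {1..n}" by (rule ideal)
  have eq: "I +>\<^bsub>mpoly_ring {1..n}\<^esub> combine F = I \<longleftrightarrow> combine F \<in> I" if "F \<in> carrier (F0 n d \<omega> I)" for F
  proof -
    have "combine F \<in> carrier (mpoly_ring {1..n})"
      using that unfolding F0_def by (rule combine_in_mpoly_ring) (auto simp: B0_iff)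
    then show ?thesis using rcos_const_imp_mem a_rcos_zero[OF ideal] by blast
  qed
  have "\<zero>\<^bsub>mpoly_ring {1..n} Quot I\<^esub> = I" by (simp add: FactRing_def)
  then show ?thesis
    unfolding a_kernel_def' \<psi>0_def by (intro Collect_cong conj_cong refl) (simp only: eq)
qed

text \<open>\<open>N\<close> is an arbitrary submodule containing the h_\<alpha> because the
  generated submodule is defined as the intersection of all of these.\<close>

lemma kernel_subset_submodule:
  assumes N: "submodule N (mpoly_ring {n - d + 1..n}) (F0 n d \<omega> I)"
    and h: "h_elem n d \<omega> I ` B1' n d \<omega> I \<subseteq> N"
    and F: "F \<in> carrier (F0 n d \<omega> I)" "combine F \<in> I"
  shows "F \<in> N"
proof -
  let ?W = "{n - d + 1..n}"
  have W: "?W \<subseteq> {1..n}" by auto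
  note N' = N[unfolded F0_def]
  have 0: "F \<in> N" if "F \<in> carrier (F0 n d \<omega> I)" "combine F = 0" for F
    using that combine_eq_0[of F ?W "B0 n d \<omega> I"] B0_disjoint submodule_free_module_0[OF N']
    by (auto simp: F0_def)
  \<comment> \<open>The induction variable is the initial monomial of \<open>combine F\<close>, with
    \<open>F\<close> generalized; a zero image has no initial monomial and is covered by the fact
    \<open>0\<close>.\<close>
  have nonzero: "F \<in> N" if "keys \<mu> \<subseteq> {1..n}" "F \<in> carrier (F0 n d \<omega> I)" "combine F \<in> I"
    "combine F \<noteq> 0" "lead_mon \<omega> (combine F) = \<mu>" for \<mu> F
    using wf_wrevlex[OF finite_atLeastAtMost weights_pos] that
  proof (induction \<mu> arbitrary: F rule: wf_induct_rule)
    case (less \<mu>)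
    note F = less.prems(2-5)
    let ?p = "combine F"
    have \<mu>: "\<mu> \<in> keys ?p" "\<mu> \<in> leads" using lead_mon_in_keys lead_in_leads F by auto
    \<comment> \<open>Some term of \<open>F\<close> must produce \<mu>; since \<open>F\<close> has
      its indices in B0 and its coefficients in A, this yields the splitting of \<mu>.\<close>
    obtain v M where vM: "v \<in> keys F" "M \<in> keys (lookup F v)" "\<mu> = v + M"
      using \<mu>(1) by (rule keys_combine)
    have v: "v \<in> B0 n d \<omega> I" and M: "keys M \<subseteq> ?W"
      using vM F(1) by (auto simp: F0_def mem_free_module mem_mpoly_ring)
    have "M \<in> colon_mons d v" using vM(3) \<mu>(2) M by (simp add: colon_mons_def)
    then obtain M' N' where M': "M' \<in> minimal_mons (colon_mons d v)" "M = M' + N'"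
      by (rule minimal_mons_below)
    define \<alpha> where "\<alpha> = v + M'"
    have keys: "keys M' \<subseteq> ?W" "keys N' \<subseteq> ?W" using M M'(2) by (auto simp: keys_add_nat)
    have "\<alpha> \<in> leads" using M'(1) by (simp add: \<alpha>_def minimal_mons_def colon_mons_def)
    moreover have "\<alpha> \<in> B1' n d \<omega> I" unfolding B1'_eq \<alpha>_def using M'(1) v by blast
    ultimately have \<alpha>: "\<alpha> \<in> leads" "keys \<alpha> \<subseteq> {1..n}" "\<alpha> \<in> B1' n d \<omega> I" "\<mu> = N' + \<alpha>"
      using leads_keys by (auto simp: \<alpha>_def vM(3) M'(2) ac_simps)
    let ?r = "remainder n \<omega> (reduced_gb n \<omega> I) (xpow \<alpha>)"
    note r = remainder_xpow[OF \<alpha>(2)]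
    note h_elem = h_elem[OF v keys(1), folded \<alpha>_def]
    \<comment> \<open>The multiplier is dictated by \<mu>: \<open>N'\<close> is the cofactor
      carrying \<alpha> to \<mu>, and \<open>c\<close> is the coefficient to be cancelled.\<close>
    define c where "c = lookup ?p \<mu>"
    define G where "G = Poly_Mapping.map ((*) (single N' c)) (h_elem n d \<omega> I \<alpha>)"
    have A: "single N' c \<in> carrier (mpoly_ring ?W)" using keys(2) by (rule mpoly_ring_single)
    have G: "G \<in> carrier (F0 n d \<omega> I)" "G \<in> N"
      using A h_elem(1) h \<alpha>(3) submodule_free_module_smult[OF N']
      unfolding G_def F0_def by (auto intro: free_module_smult)
    have combine_G: "combine G = single N' c * (xpow \<alpha> - ?r)"
      unfolding G_def combine_smult h_elem(2) ..
    have "combine G \<in> I"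
      unfolding combine_G using mpoly_ring_mono[OF W A] r(4) by (rule ideal_mpoly_mult[OF ideal])
    then have F': "F - G \<in> carrier (F0 n d \<omega> I)" "combine (F - G) \<in> I"
      using F G unfolding F0_def
      by (simp_all add: free_module_diff combine_diff ideal_mpoly_diff[OF ideal])
    have less_\<mu>: "wrevlex_greater \<omega> \<mu> \<kappa>" if \<kappa>: "\<kappa> \<in> keys (combine (F - G))" for \<kappa>
    proof -
      \<comment> \<open>The monomial \<alpha> lies in in(I) while the remainder has no monomial
        there, so x^\<alpha> - r_\<alpha> has coefficient 1 at \<alpha>, and the multiplier moves
        \<open>c\<close> to \<mu>.\<close>
      have "\<alpha> \<notin> keys ?r" using r(2) \<alpha>(1) by blast
      then have "lookup (combine G) \<mu> = c"
        unfolding combine_G \<alpha>(4) by (simp add: lookup_single_mult lookup_minus xpow_def in_keys_iff)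
      then have "\<kappa> \<noteq> \<mu>" using \<kappa> by (auto simp: combine_diff lookup_minus in_keys_iff c_def)
      have "\<kappa> \<in> keys ?p \<or> \<kappa> \<in> keys (combine G)"
        using \<kappa> keys_diff[of ?p "combine G"] by (auto simp: combine_diff)
      then show ?thesis
      proof
        assume "\<kappa> \<in> keys ?p"
        then show ?thesis using lead_mon_greatest[OF F(3), of \<kappa> \<omega>] F(4) \<open>\<kappa> \<noteq> \<mu>\<close> by auto
      next
        assume "\<kappa> \<in> keys (combine G)"
        then obtain \<kappa>' where \<kappa>': "\<kappa> = N' + \<kappa>'" "\<kappa>' \<in> keys (xpow \<alpha> - ?r)"
          unfolding combine_G using keys_single_mult by blast
        \<comment> \<open>The remainder bound only gives "at most \<alpha>"; being different from
          \<alpha> makes \<kappa>' strictly smaller, and the order is compatible with multiplication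
          by \<open>N'\<close>.\<close>
        then have "\<kappa>' \<noteq> \<alpha>" using \<open>\<kappa> \<noteq> \<mu>\<close> \<alpha>(4) by auto
        then have "\<kappa>' \<in> keys ?r" using \<kappa>'(2) keys_diff[of "xpow \<alpha>" ?r] by (auto simp: keys_xpow)
        then have "wrevlex_greater \<omega> \<alpha> \<kappa>'"
          using r(3) wrevlex_total[OF \<open>\<kappa>' \<noteq> \<alpha>\<close>, of \<omega>] by blast
        then show ?thesis by (simp add: \<alpha>(4) \<kappa>'(1) wrevlex_add_left)
      qed
    qed
    have "F - G \<in> N"
    proof (cases "combine (F - G) = 0")
      case False
      let ?\<nu> = "lead_mon \<omega> (combine (F - G))"
      have "wrevlex_greater \<omega> \<mu> ?\<nu>" using less_\<mu> lead_mon_in_keys[OF False] by blast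
      moreover have "keys ?\<nu> \<subseteq> {1..n}" using leads_keys lead_in_leads[OF F'(2) False] by blast
      ultimately show ?thesis using less.prems(1) F' False by (intro less.IH[of ?\<nu>]) auto
    qed (use 0 F'(1) in blast)
    then have "F - G + G \<in> N"
      using G(2) by (rule submodule_free_module_add[OF N'])
    then show ?case by simp
  qed
  show ?thesis
  proof (cases "combine F = 0")
    case False
    show ?thesis by (rule nonzero[OF leads_keys[OF lead_in_leads[OF F(2) False]] F False refl])
  qed (use 0 F in blast)
qed

end

theorem proposition1p2:
  fixes n d :: nat and \<omega> :: "nat \<Rightarrow> nat" and I :: "'k::field mpoly set"
  assumes "\<forall>i\<in>{1..n}. \<omega> i > 0"
    and "homogeneous_ideal {1..n} \<omega> I"
    and "krull_dim (mpoly_ring {1..n} Quot I) = ereal (real d)"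
    and "noether_normalization n d I"
  shows "a_kernel (F0 n d \<omega> I) (mpoly_ring {1..n} Quot I) (\<psi>0 n I)
       = submodule_generated (mpoly_ring {n - d + 1..n}) (F0 n d \<omega> I) (h_elem n d \<omega> I ` B1' n d \<omega> I)"
proof -
  interpret weighted_ideal n \<omega> I
    using assms(1,2) by (intro weighted_ideal.intro) (simp_all add: homogeneous_ideal_def)
  let ?A = "mpoly_ring {n - d + 1..n} :: 'k mpoly ring" and ?K = "{F \<in> carrier (F0 n d \<omega> I). combine F \<in> I}"
  have "submodule ?K ?A (F0 n d \<omega> I)"
    unfolding F0_def
  proof (rule submodule_free_moduleI)
    fix a :: "'k mpoly" and F :: "mon \<Rightarrow>\<^sub>0 'k mpoly"
    assume a: "a \<in> carrier ?A"
      and F: "F \<in> {F \<in> carrier (free_module {n - d + 1..n} (B0 n d \<omega> I)). combine F \<in> I}"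
    have "a \<in> carrier (mpoly_ring {1..n})" using a by (rule mpoly_ring_mono[rotated]) auto
    then show "Poly_Mapping.map ((*) a) F \<in>
        {F \<in> carrier (free_module {n - d + 1..n} (B0 n d \<omega> I)). combine F \<in> I}"
      using a F by (auto simp: combine_smult free_module_smult ideal_mpoly_mult[OF ideal])
  qed (auto simp: free_module_0 combine_0 ideal_mpoly_0[OF ideal] free_module_add combine_add
      ideal_mpoly_add[OF ideal])
  moreover have "h_elem n d \<omega> I ` B1' n d \<omega> I \<subseteq> ?K"
  proof
    fix h assume "h \<in> h_elem n d \<omega> I ` B1' n d \<omega> I"
    then obtain u M where uM: "h = h_elem n d \<omega> I (u + M)" "u \<in> B0 n d \<omega> I" "M \<in> colon_mons d u"
      unfolding B1'_eq minimal_mons_def by blast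
    then have "keys M \<subseteq> {n - d + 1..n}" "keys (u + M) \<subseteq> {1..n}"
      using leads_keys by (auto simp: colon_mons_def)
    then show "h \<in> ?K" using h_elem[OF uM(2)] remainder_xpow(4) uM(1) by simp
  qed
  \<comment> \<open>\<open>?K\<close> is itself one of the submodules being intersected, which gives
    one inclusion; the descent places it inside every such submodule, which gives the other.\<close>
  ultimately show ?thesis
    unfolding a_kernel_eq submodule_generated_def using kernel_subset_submodule by blast
qed

end
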